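(* Let $V$ be a pure odd real vector space of dimension $m$ with an even non-degenerate skew-symmetric (in the super sense) bilinear form $(\,,)$; since $V$ is pure odd, this means $(a,b)=(b,a)$ for all $a,b\in V$. Let $\xi_1,\ldots,\xi_m$ be a normalized orthogonal basis of $V$. Then the real invariant $(m-3)$-ary algebra structures on $V$, up to isomorphism, are parametrized by the vectors $$v=a_1\xi_1\xi_2+\cdots+a_k\xi_{2k-1}\xi_{2k},\qquad a_j\in\mathbb R,$$ where $0\le a_k\le\cdots\le a_1$ if $m=2k+1$, and $|a_k|\le\cdots\le a_1$ if $m=2k$. Explicitly, such algebras are given by the derived potentials $\mu_v=*(v)$.
   Context: Since $V$ is pure odd, the symmetric power $S^pV$ (in the super sense) is the ordinary exterior power $\bigwedge^pV$, with elements of parity $p\bmod2$; $S^*V=\bigoplus_pS^pV$, $S^0V=\mathbb R$. The Poisson bracket $[\,,]$ on $S^*V$ is the bilinear operation, zero when one argument is a scalar, determined by $[x,y]=(x,y)$ for $x,y\in V$, $[v,w_1w_2]=[v,w_1]w_2+(-1)^{pq}w_1[v,w_2]$ for $v\in S^pV$, $w_1\in S^qV$, and $[v,w]=-(-1)^{pq}[w,v]$ for $v\in S^pV$, $w\in S^qV$. An invariant $n$-ary algebra structure on $V$ is an alternating $n$-linear map $\{\ldots\}:V^n\to V$ with $(a_0,\{a_1,\ldots,a_n\})=-(a_1,\{a_0,a_2,\ldots,a_n\})$ for all $a_i\in V$. The structure with derived potential $\mu\in S^{n+1}V$ is $\{a_1,\ldots,a_n\}=[a_1,[\ldots,[a_n,\mu]\ldots]]$.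 $\mathrm{SO}(V)$ is the group of linear operators of determinant $1$ preserving $(\,,)$. Two $n$-ary structures $\{\ldots\}$, $\{\ldots\}'$ on $V$ are isomorphic if there is $\varphi\in\mathrm{SO}(V)$ with $\varphi(\{v_1,\ldots,v_n\})=\{\varphi(v_1),\ldots,\varphi(v_n)\}'$ for all $v_i\in V$. With $L=\xi_1\cdots\xi_m$, the linear map $*:S^pV\to S^{m-p}V$ is given by $*(x_1\cdots x_p)=[x_1,[\ldots,[x_p,L]\ldots]]$ for $x_i\in V$. *)

theory Defs
  imports
    "HOL-Analysis.Linear_Algebra"
    "HOL-Library.Poly_Mapping"
    "HOL-Library.FuncSet"
    "Jordan_Normal_Form.Determinant"
begin

section \<open>The exterior algebra of a real vector space\<close>

text \<open>
  With concatenation as addition, lists over \<^typ>\<open>'v\<close> form the free monoid on \<^typ>\<open>'v\<close>, so that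
  finitely supported functions on them, with the convolution product of
  \<^theory>\<open>HOL-Library.Poly_Mapping\<close>, form the free associative unital real algebra on the
  set \<^typ>\<open>'v\<close>.
\<close>

instantiation list :: (type) monoid_add
begin
definition zero_list_def: "0 = ([] :: 'a list)"
definition plus_list_def: "(xs :: 'a list) + ys = xs @ ys"
instance by intro_classes (simp_all add: zero_list_def plus_list_def)
end

inductive_set ext_relators :: "('v::real_vector list \<Rightarrow>\<^sub>0 real) set" where
  "Poly_Mapping.single [x + y] 1 - Poly_Mapping.single [x] 1 - Poly_Mapping.single [y] 1 \<in> ext_relators"
| "Poly_Mapping.single [c *\<^sub>R x] 1 - Poly_Mapping.single [x] c \<in> ext_relators"
| "Poly_Mapping.single [x, x] 1 \<in> ext_relators"

inductive_set ext_ideal :: "('v::real_vector list \<Rightarrow>\<^sub>0 real) set" where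
  gen: "g \<in> ext_relators \<Longrightarrow> p * g * q \<in> ext_ideal"
| add: "a \<in> ext_ideal \<Longrightarrow> b \<in> ext_ideal \<Longrightarrow> a + b \<in> ext_ideal"

lemma ext_ideal_0: "0 \<in> ext_ideal"
  using ext_ideal.gen[OF ext_relators.intros(3), of 0 _ 0] by simp

lemma ext_ideal_mult: "a \<in> ext_ideal \<Longrightarrow> p * a * q \<in> ext_ideal"
proof (induction rule: ext_ideal.induct)
  case (gen g p' q')
  then show ?case using ext_ideal.gen[of g "p * p'" "q' * q"] by (simp add: mult.assoc)
next
  case (add a b)
  then show ?case by (simp add: algebra_simps ext_ideal.add)
qed

lemma ext_ideal_mult_left: "a \<in> ext_ideal \<Longrightarrow> p * a \<in> ext_ideal"
  using ext_ideal_mult[of a p 1] by simp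

lemma ext_ideal_mult_right: "a \<in> ext_ideal \<Longrightarrow> a * q \<in> ext_ideal"
  using ext_ideal_mult[of a 1 q] by simp

lemma ext_ideal_uminus: "a \<in> ext_ideal \<Longrightarrow> - a \<in> ext_ideal"
  using ext_ideal_mult_left[of a "-1"] by simp

lemma ext_ideal_diff: "a \<in> ext_ideal \<Longrightarrow> b \<in> ext_ideal \<Longrightarrow> a - b \<in> ext_ideal"
  using ext_ideal.add[of a "- b"] ext_ideal_uminus by fastforce

lemma lookup_mult_Nil:
  fixes a b :: "'v list \<Rightarrow>\<^sub>0 real"
  shows "Poly_Mapping.lookup (a * b) [] = Poly_Mapping.lookup a [] * Poly_Mapping.lookup b []"
proof -
  have *: "Sum_any (\<lambda>q. Poly_Mapping.lookup b q when [] = l + q) = (Poly_Mapping.lookup b [] when l = [])"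
    for l :: "'v list"
  proof -
    have "Sum_any (\<lambda>q. Poly_Mapping.lookup b q when [] = l + q)
        = Sum_any (\<lambda>q. (Poly_Mapping.lookup b q when l = []) when q = [])"
      by (rule arg_cong[where f = Sum_any]) (auto simp: fun_eq_iff plus_list_def when_def)
    then show ?thesis by simp
  qed
  have "Poly_Mapping.lookup (a * b) []
      = Sum_any (\<lambda>l. Poly_Mapping.lookup a l * (Poly_Mapping.lookup b [] when l = []))"
    by (simp add: lookup_mult *)
  also have "\<dots> = Sum_any (\<lambda>l. (Poly_Mapping.lookup a l * Poly_Mapping.lookup b []) when l = [])"
    by (rule arg_cong[where f = Sum_any]) (auto simp: fun_eq_iff when_def)
  finally show ?thesis by simp
qed

lemma ext_ideal_lookup_Nil: "a \<in> ext_ideal \<Longrightarrow> Poly_Mapping.lookup a [] = 0"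
proof (induction rule: ext_ideal.induct)
  case (gen g p q)
  then have "Poly_Mapping.lookup g [] = 0"
    by cases (simp_all add: lookup_minus lookup_single)
  then show ?case by (simp add: lookup_mult_Nil)
qed (simp add: lookup_add)

definition ext_rel :: "('v::real_vector list \<Rightarrow>\<^sub>0 real) \<Rightarrow> ('v list \<Rightarrow>\<^sub>0 real) \<Rightarrow> bool" where
  "ext_rel p q \<longleftrightarrow> p - q \<in> ext_ideal"

lemma equivp_ext_rel: "equivp (ext_rel :: ('v::real_vector list \<Rightarrow>\<^sub>0 real) \<Rightarrow> _)"
proof (rule equivpI)
  show "reflp (ext_rel :: ('v list \<Rightarrow>\<^sub>0 real) \<Rightarrow> _)"
    by (simp add: reflp_def ext_rel_def ext_ideal_0)
  show "symp (ext_rel :: ('v list \<Rightarrow>\<^sub>0 real) \<Rightarrow> _)"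
    by (metis sympI ext_rel_def ext_ideal_uminus minus_diff_eq)
  show "transp (ext_rel :: ('v list \<Rightarrow>\<^sub>0 real) \<Rightarrow> _)"
  proof (rule transpI)
    fix x y z :: "'v list \<Rightarrow>\<^sub>0 real"
    assume "ext_rel x y" "ext_rel y z"
    then show "ext_rel x z"
      using ext_ideal.add[of "x - y" "y - z"] by (simp add: ext_rel_def)
  qed
qed

lemma ext_rel_refl: "ext_rel p p"
  by (simp add: ext_rel_def ext_ideal_0)

lemma poly_mapping_additive_induct [case_names single add]:
  fixes p :: "'b \<Rightarrow>\<^sub>0 'c::comm_monoid_add"
  assumes single: "\<And>k c. P (Poly_Mapping.single k c)"
    and add: "\<And>p q. P p \<Longrightarrow> P q \<Longrightarrow> P (p + q)"
  shows "P p"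
proof -
  have "P (\<Sum>k\<in>A. Poly_Mapping.single k (Poly_Mapping.lookup p k))" if "finite A" for A
    using that
  proof (induction A)
    case empty
    then show ?case using single[of undefined 0] by simp
  qed (simp add: single add)
  moreover have "(\<Sum>k\<in>Poly_Mapping.keys p. Poly_Mapping.single k (Poly_Mapping.lookup p k)) = p"
  proof (rule poly_mapping_eqI)
    fix i
    have "Poly_Mapping.lookup (\<Sum>k\<in>Poly_Mapping.keys p. Poly_Mapping.single k (Poly_Mapping.lookup p k)) i
      = (\<Sum>k\<in>Poly_Mapping.keys p. if k = i then Poly_Mapping.lookup p k else 0)"
      by (simp add: lookup_sum lookup_single when_def)
    also have "\<dots> = (if i \<in> Poly_Mapping.keys p then Poly_Mapping.lookup p i else 0)"
      by (rule sum.delta) (rule Poly_Mapping.finite_keys)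
    finally show "Poly_Mapping.lookup (\<Sum>k\<in>Poly_Mapping.keys p. Poly_Mapping.single k (Poly_Mapping.lookup p k)) i
      = Poly_Mapping.lookup p i"
      by (simp add: in_keys_iff)
  qed
  ultimately show ?thesis by (metis Poly_Mapping.finite_keys)
qed

lemma single_zero_comm:
  fixes p :: "'b::monoid_add \<Rightarrow>\<^sub>0 real"
  shows "p * Poly_Mapping.single 0 r = Poly_Mapping.single 0 r * p"
  by (induction p rule: poly_mapping_additive_induct)
    (simp_all add: mult_single distrib_left distrib_right mult.commute)

quotient_type (overloaded) 'v ext = "'v::real_vector list \<Rightarrow>\<^sub>0 real" / ext_rel
  by (rule equivp_ext_rel)

instantiation ext :: (real_vector) real_algebra_1
begin

lift_definition zero_ext :: "'a ext" is 0 .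
lift_definition one_ext :: "'a ext" is 1 .
lift_definition plus_ext :: "'a ext \<Rightarrow> 'a ext \<Rightarrow> 'a ext" is "(+)"
  unfolding ext_rel_def by (metis add_diff_add ext_ideal.add)
lift_definition uminus_ext :: "'a ext \<Rightarrow> 'a ext" is uminus
  unfolding ext_rel_def by (metis ext_ideal_uminus minus_diff_minus)
lift_definition minus_ext :: "'a ext \<Rightarrow> 'a ext \<Rightarrow> 'a ext" is "(-)"
proof -
  fix a b c d :: "'a list \<Rightarrow>\<^sub>0 real"
  assume "ext_rel a b" "ext_rel c d"
  then have "(a - b) - (c - d) \<in> ext_ideal"
    unfolding ext_rel_def by (rule ext_ideal_diff)
  then show "ext_rel (a - c) (b - d)" by (simp add: ext_rel_def algebra_simps)
qed
lift_definition times_ext :: "'a ext \<Rightarrow> 'a ext \<Rightarrow> 'a ext" is "(*)"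
proof -
  fix a b c d :: "'a list \<Rightarrow>\<^sub>0 real"
  assume "ext_rel a b" "ext_rel c d"
  then have "(a - b) * c + b * (c - d) \<in> ext_ideal"
    unfolding ext_rel_def by (intro ext_ideal.add ext_ideal_mult_left ext_ideal_mult_right)
  then show "ext_rel (a * c) (b * d)" by (simp add: ext_rel_def algebra_simps)
qed
lift_definition scaleR_ext :: "real \<Rightarrow> 'a ext \<Rightarrow> 'a ext" is "\<lambda>r p. Poly_Mapping.single 0 r * p"
  unfolding ext_rel_def by (metis ext_ideal_mult_left right_diff_distrib)

instance
proof
  fix a b c :: "'a ext" and r s :: real
  show "a + b + c = a + (b + c)" by transfer (simp add: add.assoc ext_rel_refl)
  show "a + b = b + a" by transfer (simp add: add.commute ext_rel_refl)
  show "0 + a = a" by transfer (simp add: ext_rel_refl)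
  show "- a + a = 0" by transfer (simp add: ext_rel_refl)
  show "a - b = a + - b" by transfer (simp add: ext_rel_refl)
  show "a * b * c = a * (b * c)" by transfer (simp add: mult.assoc ext_rel_refl)
  show "(a + b) * c = a * c + b * c" by transfer (simp add: distrib_right ext_rel_refl)
  show "a * (b + c) = a * b + a * c" by transfer (simp add: distrib_left ext_rel_refl)
  show "1 * a = a" by transfer (simp add: ext_rel_refl)
  show "a * 1 = a" by transfer (simp add: ext_rel_refl)
  show "r *\<^sub>R (a + b) = r *\<^sub>R a + r *\<^sub>R b"
    by transfer (simp add: distrib_left ext_rel_refl)
  show "(r + s) *\<^sub>R a = r *\<^sub>R a + s *\<^sub>R a"
    by transfer (simp add: single_add distrib_right ext_rel_refl)
  show "r *\<^sub>R s *\<^sub>R a = (r * s) *\<^sub>R a"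
    by transfer (simp add: mult.assoc[symmetric] mult_single ext_rel_refl)
  show "1 *\<^sub>R a = a" by transfer (simp add: ext_rel_refl)
  show "r *\<^sub>R a * b = r *\<^sub>R (a * b)" by transfer (simp add: mult.assoc ext_rel_refl)
  show "a * r *\<^sub>R b = r *\<^sub>R (a * b)"
  proof transfer
    fix a b :: "'a list \<Rightarrow>\<^sub>0 real" and r
    have "a * (Poly_Mapping.single 0 r * b) = (a * Poly_Mapping.single 0 r) * b"
      by (simp add: mult.assoc)
    also have "\<dots> = Poly_Mapping.single 0 r * (a * b)"
      unfolding single_zero_comm by (simp add: mult.assoc)
    finally show "ext_rel (a * (Poly_Mapping.single 0 r * b)) (Poly_Mapping.single 0 r * (a * b))"
      by (simp add: ext_rel_refl)
  qed
  show "(0 :: 'a ext) \<noteq> 1"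
  proof (transfer, rule notI)
    assume "ext_rel (0 :: 'a list \<Rightarrow>\<^sub>0 real) 1"
    then have "Poly_Mapping.lookup (0 - 1 :: 'a list \<Rightarrow>\<^sub>0 real) [] = 0"
      unfolding ext_rel_def by (rule ext_ideal_lookup_Nil)
    then show False by (simp add: lookup_minus lookup_one zero_list_def)
  qed
qed

end

lift_definition ext_gen :: "'v::real_vector \<Rightarrow> 'v ext" is "\<lambda>x. Poly_Mapping.single [x] 1" .

abbreviation ext_mon :: "'v::real_vector list \<Rightarrow> 'v ext" where
  "ext_mon xs \<equiv> prod_list (map ext_gen xs)"

definition ext_pow :: "nat \<Rightarrow> 'v::real_vector ext set" where
  "ext_pow p = span (ext_mon ` {xs. length xs = p})"

lemma ext_relator_eq: "p - q - r \<in> ext_relators \<Longrightarrow> ext_rel p (q + r)"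
  using ext_ideal.gen[of "p - q - r" 1 1] by (simp add: ext_rel_def algebra_simps)

lemma ext_gen_add: "ext_gen (x + y) = ext_gen x + ext_gen y"
  by transfer (rule ext_relator_eq, rule ext_relators.intros)

lemma ext_gen_scaleR: "ext_gen (c *\<^sub>R x) = c *\<^sub>R ext_gen x"
proof transfer
  fix c :: real and x :: 'a
  have "Poly_Mapping.single 0 c * Poly_Mapping.single [x] 1 = Poly_Mapping.single [x] c"
    by (simp add: mult_single)
  then show "ext_rel (Poly_Mapping.single [c *\<^sub>R x] 1)
      (Poly_Mapping.single 0 c * Poly_Mapping.single [x] 1)"
    using ext_ideal.gen[OF ext_relators.intros(2)[of c x], of 1 1] by (simp add: ext_rel_def)
qed

lemma linear_ext_gen: "linear ext_gen"
  by (rule linearI) (simp_all add: ext_gen_add ext_gen_scaleR)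

lemma ext_gen_sq: "ext_gen x * ext_gen x = 0"
  by transfer (use ext_ideal.gen[OF ext_relators.intros(3), of 1 _ 1] in
    \<open>simp add: ext_rel_def mult_single plus_list_def\<close>)

lemma ext_gen_anticomm: "ext_gen x * ext_gen y = - (ext_gen y * ext_gen x)"
proof -
  have "ext_gen (x + y) * ext_gen (x + y) = 0" by (rule ext_gen_sq)
  then show ?thesis
    by (simp add: ext_gen_add distrib_left distrib_right ext_gen_sq add_eq_0_iff)
qed

lemma abs_ext_add: "abs_ext (p + q) = abs_ext p + abs_ext q"
  by (simp add: plus_ext.abs_eq)

lemma abs_ext_single: "abs_ext (Poly_Mapping.single xs c) = c *\<^sub>R ext_mon xs"
proof -
  have Cons: "abs_ext (Poly_Mapping.single (x # xs) 1) = ext_gen x * abs_ext (Poly_Mapping.single xs 1)"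
    for x :: 'a and xs
    by (simp add: ext_gen.abs_eq times_ext.abs_eq mult_single plus_list_def)
  have Nil: "abs_ext (Poly_Mapping.single ([] :: 'a list) 1) = 1"
    by (simp add: one_ext.abs_eq flip: zero_list_def)
  have "abs_ext (Poly_Mapping.single xs 1) = ext_mon xs"
    by (induction xs) (simp_all add: Nil Cons)
  moreover have "abs_ext (Poly_Mapping.single xs c) = c *\<^sub>R abs_ext (Poly_Mapping.single xs 1)"
    by (simp add: scaleR_ext.abs_eq mult_single)
  ultimately show ?thesis by simp
qed

lemma abs_ext_surj: "\<exists>p. a = abs_ext p"
  by (metis Quotient_abs_rep Quotient_ext)

lemma ext_induct [case_names add scale mon]:
  assumes add: "\<And>a b. P a \<Longrightarrow> P b \<Longrightarrow> P (a + b)"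
    and scale: "\<And>c a. P a \<Longrightarrow> P (c *\<^sub>R a)"
    and mon: "\<And>xs. P (ext_mon xs)"
  shows "P a"
proof -
  obtain p where "a = abs_ext p" using abs_ext_surj by blast
  moreover have "P (abs_ext p)"
    by (induction p rule: poly_mapping_additive_induct)
      (auto simp: abs_ext_single abs_ext_add intro: add scale mon)
  ultimately show ?thesis by simp
qed

lemma ext_linear_eqI:
  assumes "linear f" "linear g" "\<And>xs. f (ext_mon xs) = g (ext_mon xs)"
  shows "f a = g a"
  by (induction a rule: ext_induct) (simp_all add: assms(3) linear_add[OF assms(1)] linear_add[OF assms(2)]
      linear_scale[OF assms(1)] linear_scale[OF assms(2)])

lemma ext_pow_induct [consumes 1, case_names add scale mon]:
  assumes "a \<in> ext_pow p"
    and add: "\<And>a b. P a \<Longrightarrow> P b \<Longrightarrow> P (a + b)"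
    and scale: "\<And>c a. P a \<Longrightarrow> P (c *\<^sub>R a)"
    and mon: "\<And>xs. length xs = p \<Longrightarrow> P (ext_mon xs)"
  shows "P a"
  using assms(1) unfolding ext_pow_def
proof (induction rule: span_induct_alt)
  case base
  show ?case using scale[OF mon[of "replicate p undefined"], of 0] by simp
next
  case (step c x y)
  then show ?case using mon add scale by auto
qed

lemma ext_mon_in_pow: "ext_mon xs \<in> ext_pow (length xs)"
  unfolding ext_pow_def by (intro span_base) blast

text \<open>The universal property, in the form of a module structure on \<^typ>\<open>'e\<close>.\<close>

lemma ext_module_exists:
  fixes f :: "'v::real_vector \<Rightarrow> 'e::real_vector \<Rightarrow> 'e"
  assumes bil: "bilinear f" and sq: "\<And>x e. f x (f x e) = 0"
  shows "\<exists>F. linear F \<and> (\<forall>xs. F (ext_mon xs) = foldr f xs e)"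
proof -
  define G where "G e p = (\<Sum>xs\<in>Poly_Mapping.keys p. Poly_Mapping.lookup p xs *\<^sub>R foldr f xs e)"
    for e and p :: "'v list \<Rightarrow>\<^sub>0 real"
  have linr: "linear (f x)" for x using bil by (simp add: bilinear_def)
  have linl: "linear (\<lambda>x. f x e)" for e using bil by (simp add: bilinear_def)
  have linf: "linear (foldr f xs)" for xs
  proof (induction xs)
    case (Cons x xs)
    then show ?case using linear_compose[OF Cons linr[of x]] by (simp add: o_def)
  qed (simp add: linear_id[unfolded id_def] id_def)
  have G_sup: "G e p = (\<Sum>xs\<in>A. Poly_Mapping.lookup p xs *\<^sub>R foldr f xs e)"
    if "finite A" "Poly_Mapping.keys p \<subseteq> A" for e p A
    unfolding G_def using that by (intro sum.mono_neutral_left) (auto simp: in_keys_iff)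
  have G_add: "G e (p + q) = G e p + G e q" for e p q
  proof -
    let ?A = "Poly_Mapping.keys p \<union> Poly_Mapping.keys q"
    have "Poly_Mapping.keys (p + q) \<subseteq> ?A" by (rule keys_add)
    then show ?thesis
      by (simp add: G_sup[of ?A] lookup_add scaleR_add_left sum.distrib)
  qed
  have G_single: "G e (Poly_Mapping.single xs c) = c *\<^sub>R foldr f xs e" for e xs c
    by (simp add: G_sup[of "{xs}"])
  have G_lin: "linear (\<lambda>e. G e p)" for p
    unfolding G_def
    by (rule linearI)
      (simp_all add: linear_add[OF linf] linear_scale[OF linf] scaleR_add_right sum.distrib
        scaleR_sum_right mult.commute)
  have G_mult: "G e (p * q) = G (G e q) p" for e p q
  proof (induction p rule: poly_mapping_additive_induct)
    case (single k c)
    show ?case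
    proof (induction q rule: poly_mapping_additive_induct)
      case (single k' c')
      then show ?case
        by (simp add: mult_single G_single plus_list_def linear_scale[OF linf])
    next
      case (add p q)
      then show ?case by (simp add: distrib_left G_add linear_add[OF G_lin])
    qed
  qed (simp add: distrib_right G_add)
  have G_diff: "G e (p - q) = G e p - G e q" for e p q
    using G_add[of e "p - q" q] by (simp add: algebra_simps)
  have G_rel: "G e p = 0" if "p \<in> ext_relators" for e p
    using that
    by cases (simp_all add: G_diff G_single linear_add[OF linl] linear_scale[OF linl] sq)
  have G_ideal: "G e p = 0" if "p \<in> ext_ideal" for e p
    using that
  proof (induction arbitrary: e)
    case (gen g p q)
    then show ?case by (simp add: G_mult G_rel linear_0[OF G_lin])
  qed (simp add: G_add)
  define F where "F a = G e (rep_ext a)" for a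
  have F_of: "F (abs_ext p) = G e p" for p
  proof -
    have "ext_rel (rep_ext (abs_ext p)) p"
      by (rule Quotient_rep_abs[OF Quotient_ext ext_rel_refl])
    then have "G e (rep_ext (abs_ext p) - p) = 0" by (simp add: ext_rel_def G_ideal)
    then show ?thesis by (simp add: F_def G_diff)
  qed
  have sc: "c *\<^sub>R abs_ext p = abs_ext (Poly_Mapping.single 0 c * p)" for c p
    by (simp add: scaleR_ext.abs_eq)
  have "linear F"
  proof (rule linearI)
    fix a b :: "'v ext" and c :: real
    obtain p where a: "a = abs_ext p" using abs_ext_surj by blast
    obtain q where b: "b = abs_ext q" using abs_ext_surj by blast
    show "F (a + b) = F a + F b"
      unfolding a b abs_ext_add[symmetric] F_of by (rule G_add)
    show "F (c *\<^sub>R a) = c *\<^sub>R F a"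
      unfolding a b sc F_of G_mult G_single by (simp add: zero_list_def)
  qed
  moreover have "F (ext_mon xs) = foldr f xs e" for xs
    using F_of[of "Poly_Mapping.single xs 1"] by (simp add: abs_ext_single G_single)
  ultimately show ?thesis by (intro exI[of _ F] conjI allI)
qed

section \<open>The Poisson bracket\<close>

definition is_poisson_bracket ::
  "('v::real_vector \<Rightarrow> 'v \<Rightarrow> real) \<Rightarrow> ('v ext \<Rightarrow> 'v ext \<Rightarrow> 'v ext) \<Rightarrow> bool" where
  "is_poisson_bracket B P \<longleftrightarrow>
     bilinear P \<and>
     (\<forall>c w. P (of_real c) w = 0 \<and> P w (of_real c) = 0) \<and>
     (\<forall>x y. P (ext_gen x) (ext_gen y) = of_real (B x y)) \<and>
     (\<forall>p q v w\<^sub>1 w\<^sub>2. v \<in> ext_pow p \<longrightarrow> w\<^sub>1 \<in> ext_pow q \<longrightarrow>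
        P v (w\<^sub>1 * w\<^sub>2) = P v w\<^sub>1 * w\<^sub>2 + (-1) ^ (p * q) *\<^sub>R (w\<^sub>1 * P v w\<^sub>2)) \<and>
     (\<forall>p q v w. v \<in> ext_pow p \<longrightarrow> w \<in> ext_pow q \<longrightarrow>
        P v w = - ((-1) ^ (p * q) *\<^sub>R P w v))"

definition poisson_bracket ::
  "('v::real_vector \<Rightarrow> 'v \<Rightarrow> real) \<Rightarrow> 'v ext \<Rightarrow> 'v ext \<Rightarrow> 'v ext" where
  "poisson_bracket B = (THE P. is_poisson_bracket B P)"

lemma ext_mon_Nil_in_pow: "1 \<in> ext_pow 0"
  using ext_mon_in_pow[of "[]"] by simp

lemma ext_gen_in_pow: "ext_gen x \<in> ext_pow 1"
  using ext_mon_in_pow[of "[x]"] by simp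

lemma is_poisson_bracketD:
  assumes "is_poisson_bracket B P"
  shows "bilinear P" "P 1 w = 0" "P w 1 = 0" "P (ext_gen x) (ext_gen y) = of_real (B x y)"
    "v \<in> ext_pow p \<Longrightarrow> w\<^sub>1 \<in> ext_pow q \<Longrightarrow>
       P v (w\<^sub>1 * w\<^sub>2) = P v w\<^sub>1 * w\<^sub>2 + (-1) ^ (p * q) *\<^sub>R (w\<^sub>1 * P v w\<^sub>2)"
    "v \<in> ext_pow p \<Longrightarrow> w' \<in> ext_pow q \<Longrightarrow> P v w' = - ((-1) ^ (p * q) *\<^sub>R P w' v)"
proof -
  note d = assms[unfolded is_poisson_bracket_def]
  show "bilinear P" "P (ext_gen x) (ext_gen y) = of_real (B x y)" using d by blast+
  show "P 1 w = 0" "P w 1 = 0" using d by (metis of_real_1)+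
  show "v \<in> ext_pow p \<Longrightarrow> w\<^sub>1 \<in> ext_pow q \<Longrightarrow>
       P v (w\<^sub>1 * w\<^sub>2) = P v w\<^sub>1 * w\<^sub>2 + (-1) ^ (p * q) *\<^sub>R (w\<^sub>1 * P v w\<^sub>2)" using d by blast
  show "v \<in> ext_pow p \<Longrightarrow> w' \<in> ext_pow q \<Longrightarrow> P v w' = - ((-1) ^ (p * q) *\<^sub>R P w' v)"
    using d by blast
qed

lemma is_poisson_bracket_unique:
  assumes P: "is_poisson_bracket B P" and Q: "is_poisson_bracket B Q"
  shows "P = Q"
proof (intro ext)
  fix v w
  have lin: "linear (P a)" "linear (Q a)" "linear (\<lambda>a. P a b)" "linear (\<lambda>a. Q a b)" for a b
    using is_poisson_bracketD(1)[OF P] is_poisson_bracketD(1)[OF Q] by (auto simp: bilinear_def)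
  have gen: "P (ext_gen x) (ext_mon ys) = Q (ext_gen x) (ext_mon ys)" for x ys
    by (induction ys)
      (simp_all add: is_poisson_bracketD(2,3,4)[OF P] is_poisson_bracketD(2,3,4)[OF Q]
        is_poisson_bracketD(5)[OF P ext_gen_in_pow ext_gen_in_pow]
        is_poisson_bracketD(5)[OF Q ext_gen_in_pow ext_gen_in_pow])
  have gen': "P (ext_mon ys) (ext_gen x) = Q (ext_mon ys) (ext_gen x)" for x ys
    by (simp add: gen is_poisson_bracketD(6)[OF P ext_mon_in_pow ext_gen_in_pow]
        is_poisson_bracketD(6)[OF Q ext_mon_in_pow ext_gen_in_pow])
  have "P (ext_mon xs) (ext_mon ys) = Q (ext_mon xs) (ext_mon ys)" for xs ys
    by (induction ys)
      (simp_all add: is_poisson_bracketD(2,3,4)[OF P] is_poisson_bracketD(2,3,4)[OF Q] gen'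
        is_poisson_bracketD(5)[OF P ext_mon_in_pow ext_gen_in_pow]
        is_poisson_bracketD(5)[OF Q ext_mon_in_pow ext_gen_in_pow])
  then have "P (ext_mon xs) w = Q (ext_mon xs) w" for xs
    by (rule ext_linear_eqI[OF lin(1,2)])
  then show "P v w = Q v w"
    by (rule ext_linear_eqI[OF lin(3,4)])
qed

lemma ext_mon_supercomm:
  "ext_mon xs * ext_mon ys = (-1) ^ (length xs * length ys) *\<^sub>R (ext_mon ys * ext_mon xs)"
proof (induction xs)
  case (Cons x xs)
  have x: "ext_gen x * ext_mon ys = (-1) ^ length ys *\<^sub>R (ext_mon ys * ext_gen x)" for ys
  proof (induction ys)
    case (Cons y ys)
    have "ext_gen x * ext_mon (y # ys) = - (ext_gen y * (ext_gen x * ext_mon ys))"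
      by (simp add: mult.assoc[symmetric] ext_gen_anticomm[of x y])
    then show ?case by (simp add: Cons mult.assoc)
  qed simp
  have "ext_mon (x # xs) * ext_mon ys = ext_gen x * (ext_mon xs * ext_mon ys)"
    by (simp add: mult.assoc)
  also have "\<dots> = (-1) ^ (length xs * length ys) *\<^sub>R (ext_gen x * ext_mon ys * ext_mon xs)"
    by (simp add: Cons mult.assoc)
  also have "\<dots> = (-1) ^ (length (x # xs) * length ys) *\<^sub>R (ext_mon ys * ext_mon (x # xs))"
    by (simp add: x power_add mult.assoc mult.commute)
  finally show ?case .
qed simp

lemma is_poisson_bracket_exists:
  fixes B :: "'v::real_vector \<Rightarrow> 'v \<Rightarrow> real"
  assumes bil: "bilinear B" and sym: "\<And>x y. B x y = B y x"
  shows "\<exists>P. is_poisson_bracket B P"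
proof -
  let ?s = "\<lambda>n::nat. (-1::real) ^ n"
  have B_add: "B (x + y) z = B x z + B y z" "B z (x + y) = B z x + B z y"
    and B_scale: "B (c *\<^sub>R x) z = c * B x z" "B z (c *\<^sub>R x) = c * B z x" for x y z c
    using bil by (simp_all add: bilinear_ladd bilinear_radd bilinear_lmul bilinear_rmul)

  text \<open>The grading involution.\<close>
  have "\<exists>F :: 'v ext \<Rightarrow> 'v ext. linear F \<and> (\<forall>xs. F (ext_mon xs) = foldr (\<lambda>x a. - (ext_gen x * a)) xs 1)"
    by (rule ext_module_exists)
      (auto simp: bilinear_def ext_gen_add ext_gen_scaleR algebra_simps ext_gen_sq
        mult.assoc[symmetric] intro!: linearI)
  then obtain \<alpha> :: "'v ext \<Rightarrow> 'v ext" where \<alpha>: "linear \<alpha>"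
    and \<alpha>_mon: "\<And>xs. \<alpha> (ext_mon xs) = foldr (\<lambda>x a. - (ext_gen x * a)) xs 1" by blast
  have \<alpha>_mon: "\<alpha> (ext_mon xs) = ?s (length xs) *\<^sub>R ext_mon xs" for xs
    unfolding \<alpha>_mon by (induction xs) simp_all

  text \<open>Contraction by a vector.\<close>
  have "\<exists>D :: 'v ext \<Rightarrow> 'v ext. linear D \<and> D 1 = 0 \<and>
      (\<forall>y ys. D (ext_mon (y # ys)) = B x y *\<^sub>R ext_mon ys - ext_gen y * D (ext_mon ys))" for x
  proof -
    let ?f = "\<lambda>y (a :: 'v ext, b). (ext_gen y * a, B x y *\<^sub>R a - ext_gen y * b)"
    have "bilinear ?f"
      unfolding bilinear_def
      by (auto intro!: linearI simp: B_add B_scale ext_gen_add ext_gen_scaleR algebra_simps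
          split: prod.splits)
    moreover have "?f y (?f y e) = 0" for y e
      by (cases e) (simp add: distrib_left distrib_right right_diff_distrib mult.assoc[symmetric] ext_gen_sq zero_prod_def)
    ultimately obtain F where F: "linear F" "\<And>xs. F (ext_mon xs) = foldr ?f xs (1, 0)"
      using ext_module_exists[of ?f "(1, 0)"] by auto
    have "fst (F (ext_mon xs)) = ext_mon xs" for xs
      unfolding F by (induction xs) (auto split: prod.splits)
    moreover have "F (ext_mon (y # ys)) = ?f y (F (ext_mon ys))" for y ys
      unfolding F by simp
    ultimately have "snd (F (ext_mon (y # ys)))
        = B x y *\<^sub>R ext_mon ys - ext_gen y * snd (F (ext_mon ys))" for y ys
      by (metis (no_types, lifting) case_prod_unfold snd_conv)
    moreover have "linear (\<lambda>a. snd (F a))"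
      using linear_compose[OF F(1) linear_snd] by (simp add: o_def)
    moreover have "snd (F 1) = 0" using F(2)[of "[]"] by simp
    ultimately show ?thesis by (intro exI[of _ "\<lambda>a. snd (F a)"]) blast
  qed
  then obtain D :: "'v \<Rightarrow> 'v ext \<Rightarrow> 'v ext" where D: "\<And>x. linear (D x)" and D_1: "\<And>x. D x 1 = 0"
    and D_Cons: "\<And>x y ys. D x (ext_mon (y # ys)) = B x y *\<^sub>R ext_mon ys - ext_gen y * D x (ext_mon ys)"
    by metis
  have D_mult: "D x (ext_gen y * w) = B x y *\<^sub>R w - ext_gen y * D x w" for x y w
    by (rule ext_linear_eqI[of "\<lambda>w. D x (ext_gen y * w)" "\<lambda>w. B x y *\<^sub>R w - ext_gen y * D x w"])
      (use D_Cons[of x y] in \<open>auto intro!: linearI simp: linear_add[OF D] linear_scale[OF D] algebra_simps\<close>)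
  have D_linl: "linear (\<lambda>x. D x w)" for w
  proof (rule linearI)
    fix x y c
    have "D (x + y) (ext_mon zs) = D x (ext_mon zs) + D y (ext_mon zs)" for zs
      by (induction zs) (simp_all add: D_1 D_mult B_add algebra_simps)
    then show "D (x + y) w = D x w + D y w"
      by (rule ext_linear_eqI[OF D linear_compose_add[OF D D]])
    have "D (c *\<^sub>R x) (ext_mon zs) = c *\<^sub>R D x (ext_mon zs)" for zs
      by (induction zs) (simp_all add: D_1 D_mult B_scale algebra_simps)
    then show "D (c *\<^sub>R x) w = c *\<^sub>R D x w"
      by (rule ext_linear_eqI[OF D linear_compose_scale_right[OF D]])
  qed
  have D_leib: "D x (ext_mon ys * w) = D x (ext_mon ys) * w + ?s (length ys) *\<^sub>R (ext_mon ys * D x w)"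
    for x ys w
    by (induction ys) (simp_all add: D_1 D_mult mult.assoc algebra_simps)

  text \<open>The bracket, recursively in the first argument.\<close>
  have "\<exists>Q :: 'v ext \<Rightarrow> 'v ext. linear Q \<and> Q 1 = 0 \<and> (\<forall>x xs. Q (ext_mon (x # xs)) =
      ext_gen x * Q (ext_mon xs) + ?s (length xs) *\<^sub>R (ext_mon xs * D x w))" for w
  proof -
    let ?f = "\<lambda>x (a :: 'v ext, b). (ext_gen x * a, ext_gen x * b + \<alpha> a * D x w)"
    have \<alpha>_mult: "\<alpha> (ext_gen x * a) = - (ext_gen x * \<alpha> a)" for x a
    proof (rule ext_linear_eqI[of "\<lambda>a. \<alpha> (ext_gen x * a)" "\<lambda>a. - (ext_gen x * \<alpha> a)"])
      show "\<alpha> (ext_gen x * ext_mon xs) = - (ext_gen x * \<alpha> (ext_mon xs))" for xs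
        using \<alpha>_mon[of "x # xs"] by (simp add: \<alpha>_mon)
    qed (auto intro!: linearI simp: linear_add[OF \<alpha>] linear_scale[OF \<alpha>] algebra_simps)
    have "bilinear ?f"
      unfolding bilinear_def
      by (auto intro!: linearI simp: linear_add[OF D_linl] linear_scale[OF D_linl]
          linear_add[OF \<alpha>] linear_scale[OF \<alpha>] ext_gen_add ext_gen_scaleR algebra_simps
          split: prod.splits)
    moreover have "?f y (?f y e) = 0" for y e
      by (cases e) (simp add: \<alpha>_mult distrib_left distrib_right right_diff_distrib mult.assoc[symmetric] ext_gen_sq zero_prod_def)
    ultimately obtain F where F: "linear F" "\<And>xs. F (ext_mon xs) = foldr ?f xs (1, 0)"
      using ext_module_exists[of ?f "(1, 0)"] by auto
    have "fst (F (ext_mon xs)) = ext_mon xs" for xs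
      unfolding F by (induction xs) (auto split: prod.splits)
    moreover have "F (ext_mon (y # ys)) = ?f y (F (ext_mon ys))" for y ys
      unfolding F by simp
    ultimately have "snd (F (ext_mon (y # ys)))
        = ext_gen y * snd (F (ext_mon ys)) + \<alpha> (ext_mon ys) * D y w" for y ys
      by (metis (no_types, lifting) case_prod_unfold snd_conv)
    moreover have "linear (\<lambda>a. snd (F a))"
      using linear_compose[OF F(1) linear_snd] by (simp add: o_def)
    moreover have "snd (F 1) = 0" using F(2)[of "[]"] by simp
    ultimately show ?thesis by (intro exI[of _ "\<lambda>a. snd (F a)"]) (simp add: \<alpha>_mon)
  qed
  then obtain Q :: "'v ext \<Rightarrow> 'v ext \<Rightarrow> 'v ext" where Q: "\<And>w. linear (Q w)" and Q_1: "\<And>w. Q w 1 = 0"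
    and Q_Cons: "\<And>w x xs. Q w (ext_mon (x # xs)) =
      ext_gen x * Q w (ext_mon xs) + ?s (length xs) *\<^sub>R (ext_mon xs * D x w)"
    by metis
  define P where "P v w = Q w v" for v w
  have P_1: "P 1 w = 0" for w by (simp add: P_def Q_1)
  have P_Cons: "P (ext_gen x * ext_mon xs) w =
      ext_gen x * P (ext_mon xs) w + ?s (length xs) *\<^sub>R (ext_mon xs * D x w)" for x xs w
    using Q_Cons[of w x xs] by (simp add: P_def)
  have P_linl: "linear (\<lambda>v. P v w)" for w using Q by (simp add: P_def)
  have P_linr: "linear (P v)" for v
  proof (rule linearI)
    fix a b c
    have "P (ext_mon xs) (a + b) = P (ext_mon xs) a + P (ext_mon xs) b" for xs
      by (induction xs) (simp_all add: P_1 P_Cons linear_add[OF D] algebra_simps)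
    then show "P v (a + b) = P v a + P v b"
      by (rule ext_linear_eqI[OF P_linl linear_compose_add[OF P_linl P_linl]])
    have "P (ext_mon xs) (c *\<^sub>R a) = c *\<^sub>R P (ext_mon xs) a" for xs
      by (induction xs) (simp_all add: P_1 P_Cons linear_scale[OF D] algebra_simps)
    then show "P v (c *\<^sub>R a) = c *\<^sub>R P v a"
      by (rule ext_linear_eqI[OF P_linl linear_compose_scale_right[OF P_linl]])
  qed
  have P_gen: "P (ext_gen x) w = D x w" for x w
    using P_Cons[of x "[]" w] by (simp add: P_1)
  have P_r1: "P w 1 = 0" for w
  proof -
    have "P (ext_mon xs) 1 = 0" for xs
      by (induction xs) (simp_all add: P_1 P_Cons D_1)
    then show ?thesis by (rule ext_linear_eqI[OF P_linl linear_zero])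
  qed
  have leib_mon: "P (ext_mon xs) (ext_mon ys * w)
    = P (ext_mon xs) (ext_mon ys) * w + ?s (length xs * length ys) *\<^sub>R (ext_mon ys * P (ext_mon xs) w)"
    for xs ys w
  proof (induction xs)
    case (Cons x xs)
    have 1: "ext_gen x * (ext_mon ys * u) = ?s (length ys) *\<^sub>R (ext_mon ys * (ext_gen x * u))" for u
      using ext_mon_supercomm[of "[x]" ys] by (simp add: mult.assoc[symmetric])
    have 2: "ext_mon xs * (ext_mon ys * u)
        = ?s (length xs * length ys) *\<^sub>R (ext_mon ys * (ext_mon xs * u))" for u
      using ext_mon_supercomm[of xs ys] by (simp add: mult.assoc[symmetric])
    show ?case
      by (simp add: P_Cons Cons D_leib distrib_left distrib_right scaleR_add_right 1 2 power_add
          mult.assoc mult.commute[where 'a = real])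
  qed (simp add: P_1)
  have skew1: "P (ext_mon ys) (ext_gen x) = - (?s (length ys) *\<^sub>R D x (ext_mon ys))" for ys x
  proof (induction ys)
    case (Cons y ys)
    have "D y (ext_gen x) = B x y *\<^sub>R 1"
      using D_mult[of y x 1] by (simp add: D_1 sym)
    then show ?case by (simp add: P_Cons Cons D_mult algebra_simps)
  qed (simp add: P_1 D_1)
  have skew_mon: "P (ext_mon xs) (ext_mon ys)
    = - (?s (length xs * length ys) *\<^sub>R P (ext_mon ys) (ext_mon xs))" for xs ys
  proof (induction xs)
    case (Cons x xs)
    have l: "P (ext_mon ys) (ext_gen x * ext_mon xs) = P (ext_mon ys) (ext_gen x) * ext_mon xs
        + ?s (length ys) *\<^sub>R (ext_gen x * P (ext_mon ys) (ext_mon xs))"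
      using leib_mon[of ys "[x]" "ext_mon xs"] by simp
    have c: "ext_mon xs * D x (ext_mon ys)
      = ?s (length xs) *\<^sub>R ?s (length xs * length ys) *\<^sub>R (D x (ext_mon ys) * ext_mon xs)"
    proof (induction ys)
      case (Cons y ys)
      have 1: "ext_mon xs * ext_mon ys = ?s (length xs * length ys) *\<^sub>R (ext_mon ys * ext_mon xs)"
        by (rule ext_mon_supercomm)
      have 2: "ext_mon xs * (ext_gen y * u) = ?s (length xs) *\<^sub>R (ext_gen y * (ext_mon xs * u))" for u
        using ext_mon_supercomm[of xs "[y]"] by (simp add: mult.assoc[symmetric])
      show ?case
        by (simp add: D_mult right_diff_distrib left_diff_distrib scaleR_diff_right 1 2 Cons
            power_add mult.assoc)
    qed (simp add: D_1)
    show ?case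
      by (simp add: P_Cons Cons l skew1 c power_add scaleR_add_right
          scaleR_diff_right mult.commute[where 'a = real] mult.left_commute[where 'a = real])
  qed (simp add: P_1 P_r1)
  have "is_poisson_bracket B P"
    unfolding is_poisson_bracket_def
  proof (intro conjI allI impI)
    show "bilinear P" unfolding bilinear_def using P_linl P_linr by blast
    show "P (of_real c) w = 0" "P w (of_real c) = 0" for c w
      by (simp_all add: of_real_def linear_scale[OF P_linl] linear_scale[OF P_linr] P_1 P_r1)
    show "P (ext_gen x) (ext_gen y) = of_real (B x y)" for x y
      using D_mult[of x y 1] by (simp add: P_gen D_1 of_real_def)
  next
    fix p q :: nat and v w\<^sub>1 w\<^sub>2 :: "'v ext"
    assume "v \<in> ext_pow p" "w\<^sub>1 \<in> ext_pow q"
    then show "P v (w\<^sub>1 * w\<^sub>2) = P v w\<^sub>1 * w\<^sub>2 + ?s (p * q) *\<^sub>R (w\<^sub>1 * P v w\<^sub>2)"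
    proof (induction v rule: ext_pow_induct)
      case (mon xs)
      from mon(2,1) show ?case
        by (induction w\<^sub>1 rule: ext_pow_induct)
          (simp_all add: leib_mon linear_add[OF P_linr] linear_scale[OF P_linr] distrib_left distrib_right scaleR_add_right
            add_ac mult.commute[where 'a = real])
    qed (simp_all add: linear_add[OF P_linl] linear_scale[OF P_linl] distrib_left distrib_right scaleR_add_right
            add_ac mult.commute[where 'a = real])
  next
    fix p q :: nat and v w :: "'v ext"
    assume "v \<in> ext_pow p" "w \<in> ext_pow q"
    then show "P v w = - (?s (p * q) *\<^sub>R P w v)"
    proof (induction v rule: ext_pow_induct)
      case (mon xs)
      from mon(2,1) show ?case
        by (induction w rule: ext_pow_induct)
          (simp_all add: skew_mon[of xs] linear_add[OF P_linl] linear_scale[OF P_linl]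
            linear_add[OF P_linr] linear_scale[OF P_linr] distrib_left distrib_right scaleR_add_right
            add_ac mult.commute[where 'a = real])
    qed (simp_all add: linear_add[OF P_linl] linear_scale[OF P_linl]
            linear_add[OF P_linr] linear_scale[OF P_linr] distrib_left distrib_right scaleR_add_right
            add_ac mult.commute[where 'a = real])
  qed
  then show ?thesis by (rule exI[of _ P])
qed

lemma is_poisson_bracket_poisson_bracket:
  assumes "bilinear B" "\<And>x y. B x y = B y x"
  shows "is_poisson_bracket B (poisson_bracket B)"
  unfolding poisson_bracket_def
proof (rule theI'[where P = "is_poisson_bracket B"])
  show "\<exists>!P. is_poisson_bracket B P"
    using is_poisson_bracket_exists[OF assms] is_poisson_bracket_unique by blast
qed

definition orthonormal_basis ::
  "('v::real_vector \<Rightarrow> 'v \<Rightarrow> real) \<Rightarrow> nat \<Rightarrow> (nat \<Rightarrow> 'v) \<Rightarrow> bool" where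
  "orthonormal_basis B m \<xi> \<longleftrightarrow>
     inj_on \<xi> {1..m} \<and> independent (\<xi> ` {1..m}) \<and> span (\<xi> ` {1..m}) = UNIV \<and>
     (\<forall>i\<in>{1..m}. \<forall>j\<in>{1..m}. B (\<xi> i) (\<xi> j) = (if i = j then 1 else 0))"

definition iterated_bracket ::
  "('v::real_vector \<Rightarrow> 'v \<Rightarrow> real) \<Rightarrow> 'v list \<Rightarrow> 'v ext \<Rightarrow> 'v ext" where
  "iterated_bracket B xs w = foldr (\<lambda>x. poisson_bracket B (ext_gen x)) xs w"

section \<open>The operator \<open>*\<close>\<close>

definition is_hodge_star ::
  "('v::real_vector \<Rightarrow> 'v \<Rightarrow> real) \<Rightarrow> (nat \<Rightarrow> 'v) \<Rightarrow> nat \<Rightarrow> ('v ext \<Rightarrow> 'v ext) \<Rightarrow> bool" where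
  "is_hodge_star B \<xi> m S \<longleftrightarrow>
     linear S \<and> (\<forall>xs. S (ext_mon xs) = iterated_bracket B xs (ext_mon (map \<xi> [1..<Suc m])))"

definition hodge_star ::
  "('v::real_vector \<Rightarrow> 'v \<Rightarrow> real) \<Rightarrow> (nat \<Rightarrow> 'v) \<Rightarrow> nat \<Rightarrow> 'v ext \<Rightarrow> 'v ext" where
  "hodge_star B \<xi> m = (THE S. is_hodge_star B \<xi> m S)"

lemma is_hodge_star_hodge_star:
  assumes "bilinear B" "\<And>x y. B x y = B y x"
  shows "is_hodge_star B \<xi> m (hodge_star B \<xi> m)"
proof -
  let ?P = "poisson_bracket B"
  note P = is_poisson_bracket_poisson_bracket[OF assms]
  have lin: "linear (?P a)" "linear (\<lambda>a. ?P a b)" for a b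
    using is_poisson_bracketD(1)[OF P] by (auto simp: bilinear_def)
  have mult: "?P (ext_gen x) (ext_gen y * w) = B x y *\<^sub>R w - ext_gen y * ?P (ext_gen x) w" for x y w
    using is_poisson_bracketD(5)[OF P ext_gen_in_pow ext_gen_in_pow, of x y w]
    by (simp add: is_poisson_bracketD(4)[OF P] of_real_def)
  have "?P (ext_gen x) (?P (ext_gen x) (ext_mon ys)) = 0" for x ys
    by (induction ys)
      (simp_all add: is_poisson_bracketD(3)[OF P] linear_0[OF lin(1)] mult linear_diff[OF lin(1)]
        linear_scale[OF lin(1)])
  then have sq: "?P (ext_gen x) (?P (ext_gen x) w) = 0" for x w
    by (rule ext_linear_eqI[OF linear_compose[OF lin(1) lin(1), unfolded o_def] linear_zero])
  have "bilinear (\<lambda>x. ?P (ext_gen x))"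
    unfolding bilinear_def
    by (auto intro!: linearI simp: linear_add[OF lin(1)] linear_scale[OF lin(1)]
        linear_add[OF lin(2)] linear_scale[OF lin(2)] ext_gen_add ext_gen_scaleR)
  then have "\<exists>S. is_hodge_star B \<xi> m S"
    unfolding is_hodge_star_def iterated_bracket_def by (rule ext_module_exists) (rule sq)
  moreover have "S = T" if S: "is_hodge_star B \<xi> m S" and T: "is_hodge_star B \<xi> m T" for S T
  proof
    fix a
    have "linear S" "linear T" using S T by (simp_all add: is_hodge_star_def)
    then show "S a = T a"
      by (rule ext_linear_eqI) (use S T in \<open>simp add: is_hodge_star_def\<close>)
  qed
  ultimately have "\<exists>!S. is_hodge_star B \<xi> m S" by blast
  then show ?thesis unfolding hodge_star_def by (rule theI'[where P = "is_hodge_star B \<xi> m"])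
qed

section \<open>Invariant \<open>n\<close>-ary algebra structures\<close>

text \<open>
  An \<open>n\<close>-ary operation takes the list of its \<open>n\<close> arguments. It is kept extensional, so that
  equality of structures is equality on lists of length \<open>n\<close>.
\<close>

definition multilinear_on_lists :: "nat \<Rightarrow> ('v::real_vector list \<Rightarrow> 'v) \<Rightarrow> bool" where
  "multilinear_on_lists n f \<longleftrightarrow>
     (\<forall>as i. length as = n \<longrightarrow> i < n \<longrightarrow> linear (\<lambda>x. f (as[i := x])))"

definition alternating_on_lists :: "nat \<Rightarrow> ('v::real_vector list \<Rightarrow> 'v) \<Rightarrow> bool" where
  "alternating_on_lists n f \<longleftrightarrow> (\<forall>as. length as = n \<longrightarrow> \<not> distinct as \<longrightarrow> f as = 0)"

definition invariant_structures ::
  "('v::real_vector \<Rightarrow> 'v \<Rightarrow> real) \<Rightarrow> nat \<Rightarrow> ('v list \<Rightarrow> 'v) set" where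
  "invariant_structures B n =
     {f \<in> extensional {as. length as = n}.
        multilinear_on_lists n f \<and> alternating_on_lists n f \<and>
        (\<forall>a\<^sub>0 a\<^sub>1 as. Suc (length as) = n \<longrightarrow> B a\<^sub>0 (f (a\<^sub>1 # as)) = - B a\<^sub>1 (f (a\<^sub>0 # as)))}"

text \<open>For \<open>\<mu>\<close> of degree \<open>n + 1\<close> the iterated bracket has degree 1, hence lies in the range of
  \<^const>\<open>ext_gen\<close>.\<close>

definition derived_structure ::
  "('v::real_vector \<Rightarrow> 'v \<Rightarrow> real) \<Rightarrow> nat \<Rightarrow> 'v ext \<Rightarrow> 'v list \<Rightarrow> 'v" where
  "derived_structure B n \<mu> =
     (\<lambda>as\<in>{as. length as = n}. THE v. ext_gen v = iterated_bracket B as \<mu>)"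

text \<open>The determinant of an operator, as that of its matrix in the basis \<open>b 1, \<dots>, b m\<close>; it does
  not depend on the choice of the basis.\<close>

definition operator_det :: "(nat \<Rightarrow> 'v::real_vector) \<Rightarrow> nat \<Rightarrow> ('v \<Rightarrow> 'v) \<Rightarrow> real" where
  "operator_det b m \<phi> =
     Determinant.det (mat m m (\<lambda>(i, j). representation (b ` {1..m}) (\<phi> (b (Suc j))) (b (Suc i))))"

definition special_orthogonal ::
  "('v::real_vector \<Rightarrow> 'v \<Rightarrow> real) \<Rightarrow> (nat \<Rightarrow> 'v) \<Rightarrow> nat \<Rightarrow> ('v \<Rightarrow> 'v) set" where
  "special_orthogonal B b m =
     {\<phi>. linear \<phi> \<and> (\<forall>x y. B (\<phi> x) (\<phi> y) = B x y) \<and> operator_det b m \<phi> = 1}"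

definition structure_iso ::
  "('v::real_vector \<Rightarrow> 'v \<Rightarrow> real) \<Rightarrow> (nat \<Rightarrow> 'v) \<Rightarrow> nat \<Rightarrow> nat \<Rightarrow> (('v list \<Rightarrow> 'v) \<times> ('v list \<Rightarrow> 'v)) set" where
  "structure_iso B b m n =
     {(f, g). f \<in> invariant_structures B n \<and> g \<in> invariant_structures B n \<and>
        (\<exists>\<phi>\<in>special_orthogonal B b m. \<forall>vs. length vs = n \<longrightarrow> \<phi> (f vs) = g (map \<phi> vs))}"

section \<open>Normal forms\<close>

text \<open>With \<open>k = m div 2\<close>: \<open>0 \<le> a\<^sub>k \<le> \<dots> \<le> a\<^sub>1\<close> for odd \<open>m\<close>, and
  \<open>\<bar>a\<^sub>k\<bar> \<le> a\<^sub>k\<^sub>-\<^sub>1 \<le> \<dots> \<le> a\<^sub>1\<close> for even \<open>m\<close>, to be used for \<open>m \<ge> 3\<close>.\<close>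

definition normal_coefficients :: "nat \<Rightarrow> (nat \<Rightarrow> real) set" where
  "normal_coefficients m =
     (let k = m div 2 in
      if odd m then {a. 0 \<le> a k \<and> (\<forall>j\<in>{1..<k}. a (Suc j) \<le> a j)}
      else {a. \<bar>a k\<bar> \<le> a (k - 1) \<and> (\<forall>j\<in>{1..<k - 1}. a (Suc j) \<le> a j)})"

definition normal_vectors :: "(nat \<Rightarrow> 'v::real_vector) \<Rightarrow> nat \<Rightarrow> 'v ext set" where
  "normal_vectors \<xi> m =
     (\<lambda>a. \<Sum>j=1..m div 2. a j *\<^sub>R (ext_gen (\<xi> (2 * j - 1)) * ext_gen (\<xi> (2 * j))))
       ` normal_coefficients m"

end

theory Submission
  imports Defs "HOL-Analysis.Function_Topology"
begin

text \<open>
  The star is an isomorphism, so a structure with potential \<open>\<mu>\<close> corresponds to the bivector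
  \<open>*\<mu>\<close> up to sign, and isomorphic structures to bivectors in one orbit of \<open>SO(V)\<close>. Such a bivector
  is a skew operator \<open>A\<close>. It splits into multiples of quarter turns of planes when one repeatedly
  picks a unit vector \<open>u\<close> maximising \<open>|A u|\<close> in the orthogonal complement of the planes found
  before; this also orders the coefficients. Conversely the \<open>|a\<^sub>j|\<close> are singular values of \<open>A\<close>,
  hence invariant, and the sign of \<open>a\<^sub>k\<close> for even \<open>m\<close> is detected by the Pfaffian
  \<open>a\<^sub>1 \<cdots> a\<^sub>k\<close>, the coefficient of \<open>v\<^sup>k\<close> at \<open>k! L\<close>. That every invariant structure has a potential
  follows by induction on the degree from Euler's identity.
\<close>

text \<open>No basis of the exterior algebra is ever constructed. Homogeneous elements are told
  apart by contracting them with vectors down to scalars, and that the top degree is a line is read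
  off from the star being invertible. Consequently \<open>SO(V)\<close> can be handled as the
  isometries that fix \<open>L\<close>, the product of the basis; the matrix determinant appears
  only in establishing that description. The difference between the parities is one of orientation.
  A normal form found by an orthogonal change of basis may have the wrong one, and the cure is to
  reverse the last basis vector. For odd \<open>m\<close> this vector lies in no plane of the normal
  form; for even \<open>m\<close> it lies in the last plane, whose coefficient changes sign.
  Singular values cannot see that sign, which is why a second invariant is required.\<close>

lemma ext_pow_subspace: "subspace (ext_pow p)"
  unfolding ext_pow_def by (rule subspace_span)

lemma ext_gen_mult_in_pow:
  assumes "w \<in> ext_pow p"
  shows "ext_gen x * w \<in> ext_pow (Suc p)"
  using assms
proof (induction w rule: ext_pow_induct)
  case (mon xs)
  then show ?case using ext_mon_in_pow[of "x # xs"] by simp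
qed (simp_all add: distrib_left subspace_add[OF ext_pow_subspace] subspace_scale[OF ext_pow_subspace])

lemma ext_pow_0: "w \<in> ext_pow 0 \<Longrightarrow> \<exists>c. w = of_real c"
proof (induction w rule: ext_pow_induct)
  case (add a b)
  then show ?case by (metis of_real_add)
next
  case (scale c a)
  then show ?case by (metis of_real_mult scaleR_conv_of_real)
next
  case (mon xs)
  then show ?case by (intro exI[of _ 1]) simp
qed

lemma ext_pow_1: "w \<in> ext_pow 1 \<Longrightarrow> \<exists>x. w = ext_gen x"
proof (induction w rule: ext_pow_induct)
  case (mon xs)
  then show ?case by (auto simp: length_Suc_conv)
qed (metis ext_gen_add, metis ext_gen_scaleR)

lemma ext_gen_mult_mon_mem:
  assumes "x \<in> set ys"
  shows "ext_gen x * ext_mon ys = 0"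
  using assms
proof (induction ys)
  case (Cons y ys)
  have "ext_gen x * ext_mon (y # ys) = - (ext_gen y * (ext_gen x * ext_mon ys))"
    by (simp add: mult.assoc[symmetric] ext_gen_anticomm[of x y])
  moreover have "ext_gen x * ext_mon (x # ys) = 0"
    by (simp add: mult.assoc[symmetric] ext_gen_sq)
  ultimately show ?case using Cons by (cases "x = y") auto
qed simp

section \<open>Functoriality of the exterior algebra\<close>

text \<open>The algebra homomorphism induced by \<open>\<phi>\<close>. It is chosen from an
  existence statement, so it carries information only for linear \<open>\<phi>\<close>; as monomials
  span, the two conditions then pin it down.\<close>

definition ext_map :: "('v::real_vector \<Rightarrow> 'w::real_vector) \<Rightarrow> 'v ext \<Rightarrow> 'w ext" where
  "ext_map \<phi> = (SOME F. linear F \<and> (\<forall>xs. F (ext_mon xs) = ext_mon (map \<phi> xs)))"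

context
  fixes \<phi> :: "'v::real_vector \<Rightarrow> 'w::real_vector"
  assumes \<phi>: "linear \<phi>"
begin

text \<open>Left multiplication by \<open>ext_gen (\<phi> x)\<close> on the target algebra is linear
  in \<open>x\<close> and squares to zero, which is all that the universal property asks.\<close>

lemma ext_map_ex: "linear (ext_map \<phi>) \<and> (\<forall>xs. ext_map \<phi> (ext_mon xs) = ext_mon (map \<phi> xs))"
proof -
  let ?f = "\<lambda>x (a :: 'w ext). ext_gen (\<phi> x) * a"
  have "bilinear ?f"
    unfolding bilinear_def
    by (auto intro!: linearI simp: linear_add[OF \<phi>] linear_scale[OF \<phi>] ext_gen_add ext_gen_scaleR algebra_simps)
  moreover have "?f x (?f x e) = 0" for x e
    by (simp add: mult.assoc[symmetric] ext_gen_sq)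
  ultimately obtain F where "linear F" "\<And>xs. F (ext_mon xs) = foldr ?f xs 1"
    using ext_module_exists[of ?f 1] by blast
  moreover have "foldr ?f xs 1 = ext_mon (map \<phi> xs)" for xs by (induction xs) simp_all
  ultimately have "\<exists>F. linear F \<and> (\<forall>xs. F (ext_mon xs) = ext_mon (map \<phi> xs))" by auto
  then show ?thesis unfolding ext_map_def by (rule someI_ex)
qed

lemma linear_ext_map: "linear (ext_map \<phi>)"
  and ext_map_mon: "ext_map \<phi> (ext_mon xs) = ext_mon (map \<phi> xs)"
  using ext_map_ex by simp_all

lemma ext_map_1: "ext_map \<phi> 1 = 1"
  using ext_map_mon[of "[]"] by simp

lemma ext_map_gen: "ext_map \<phi> (ext_gen x) = ext_gen (\<phi> x)"
  using ext_map_mon[of "[x]"] by simp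

lemma ext_map_mult: "ext_map \<phi> (a * b) = ext_map \<phi> a * ext_map \<phi> b"
proof (induction a rule: ext_induct)
  case (mon xs)
  show ?case
  proof (induction b rule: ext_induct)
    case (mon ys)
    have "ext_map \<phi> (ext_mon (xs @ ys)) = ext_mon (map \<phi> (xs @ ys))" by (rule ext_map_mon)
    then show ?case by (simp add: ext_map_mon)
  qed (simp_all add: algebra_simps linear_add[OF linear_ext_map] linear_scale[OF linear_ext_map])
qed (simp_all add: algebra_simps linear_add[OF linear_ext_map] linear_scale[OF linear_ext_map])

lemma ext_map_power: "ext_map \<phi> (a ^ k) = ext_map \<phi> a ^ k"
  by (induction k) (simp_all add: ext_map_1 ext_map_mult)

lemma ext_map_in_pow: "w \<in> ext_pow p \<Longrightarrow> ext_map \<phi> w \<in> ext_pow p"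
proof (induction w rule: ext_pow_induct)
  case (mon xs)
  then show ?case using ext_mon_in_pow[of "map \<phi> xs"] by (simp add: ext_map_mon)
qed (simp_all add: linear_add[OF linear_ext_map] linear_scale[OF linear_ext_map]
    subspace_add[OF ext_pow_subspace] subspace_scale[OF ext_pow_subspace])

end

lemma ext_map_id: "ext_map (\<lambda>x. x) w = w"
  by (induction w rule: ext_induct)
    (simp_all add: linear_add[OF linear_ext_map[OF linear_ident]]
      linear_scale[OF linear_ext_map[OF linear_ident]] ext_map_mon[OF linear_ident])

lemma ext_map_comp:
  assumes "linear \<phi>" "linear \<psi>"
  shows "ext_map (\<lambda>x. \<psi> (\<phi> x)) w = ext_map \<psi> (ext_map \<phi> w)"
proof (rule ext_linear_eqI[of "ext_map (\<lambda>x. \<psi> (\<phi> x))" "\<lambda>w. ext_map \<psi> (ext_map \<phi> w)"])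
  have 0: "linear (\<lambda>x. \<psi> (\<phi> x))" using linear_compose[OF assms] by (simp add: o_def)
  show "linear (ext_map (\<lambda>x. \<psi> (\<phi> x)))" by (rule linear_ext_map[OF 0])
  show "linear (\<lambda>w. ext_map \<psi> (ext_map \<phi> w))"
    using linear_compose[OF linear_ext_map[OF assms(1)] linear_ext_map[OF assms(2)]] by (simp add: o_def)
  show "ext_map (\<lambda>x. \<psi> (\<phi> x)) (ext_mon xs) = ext_map \<psi> (ext_map \<phi> (ext_mon xs))" for xs
    using ext_map_mon[OF assms(2), of "map \<phi> xs"]
    by (simp add: ext_map_mon[OF assms(1)] ext_map_mon[OF 0] o_def)
qed

section \<open>Contraction\<close>

locale symmetric_form =
  fixes B :: "'v::real_vector \<Rightarrow> 'v \<Rightarrow> real"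
  assumes bil: "bilinear B" and sym: "B x y = B y x"
begin

lemma is_poisson: "is_poisson_bracket B (poisson_bracket B)"
  using bil sym by (rule is_poisson_bracket_poisson_bracket)

lemma B_add: "B (x + y) z = B x z + B y z" "B z (x + y) = B z x + B z y"
  and B_diff: "B (x - y) z = B x z - B y z" "B z (x - y) = B z x - B z y"
  and B_scale: "B (c *\<^sub>R x) z = c * B x z" "B z (c *\<^sub>R x) = c * B z x"
  and B_minus: "B (- x) z = - B x z" "B z (- x) = - B z x"
  and B_0: "B 0 z = 0" "B z 0 = 0"
  using bil by (simp_all add: bilinear_ladd bilinear_radd bilinear_lmul bilinear_rmul
      bilinear_lsub bilinear_rsub bilinear_lneg bilinear_rneg bilinear_lzero bilinear_rzero)

lemma linear_B: "linear (B x)" "linear (\<lambda>x. B x y)"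
  using bil by (simp_all add: bilinear_def)

lemma B_sum: "B (sum f A) z = (\<Sum>i\<in>A. B (f i) z)" "B z (sum f A) = (\<Sum>i\<in>A. B z (f i))"
  by (rule linear_sum[OF linear_B(2)], rule linear_sum[OF linear_B(1)])

text \<open>Iterated brackets only ever bracket with a vector, so this contraction is all of the
  Poisson bracket that the proof uses. It is an odd derivation, determined by \<open>D_1\<close> and
  \<open>D_mult\<close>.\<close>

definition D :: "'v \<Rightarrow> 'v ext \<Rightarrow> 'v ext" where
  "D x = poisson_bracket B (ext_gen x)"

lemma linear_D: "linear (D x)"
  using is_poisson_bracketD(1)[OF is_poisson] by (simp add: bilinear_def D_def)

lemmas D_add = linear_add[OF linear_D] and D_diff = linear_diff[OF linear_D]
  and D_scale = linear_scale[OF linear_D] and D_0 = linear_0[OF linear_D]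
  and D_sum = linear_sum[OF linear_D]

lemma linear_D_left: "linear (\<lambda>x. D x w)"
proof -
  have "linear (\<lambda>a. poisson_bracket B a w)"
    using is_poisson_bracketD(1)[OF is_poisson] by (simp add: bilinear_def)
  from linear_compose[OF linear_ext_gen this] show ?thesis by (simp add: D_def o_def)
qed

lemmas D_left_add = linear_add[OF linear_D_left] and D_left_scale = linear_scale[OF linear_D_left]

lemma D_1: "D x 1 = 0"
  using is_poisson_bracketD(3)[OF is_poisson] by (simp add: D_def)

lemma D_mult: "D x (ext_gen y * w) = B x y *\<^sub>R w - ext_gen y * D x w"
  using is_poisson_bracketD(5)[OF is_poisson ext_gen_in_pow ext_gen_in_pow, of x y w]
  by (simp add: D_def is_poisson_bracketD(4)[OF is_poisson] of_real_def)

lemma D_gen: "D x (ext_gen y) = B x y *\<^sub>R 1"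
  using D_mult[of x y 1] by (simp add: D_1)

lemma D_of_real: "D x (of_real c) = 0"
  by (simp add: of_real_def D_scale D_1)

lemma D_in_pow: "w \<in> ext_pow (Suc p) \<Longrightarrow> D x w \<in> ext_pow p"
proof -
  have mon: "D x (ext_mon xs) \<in> ext_pow p" if "length xs = Suc p" for xs p
    using that
  proof (induction p arbitrary: xs)
    case 0
    then show ?case
      by (auto simp: length_Suc_conv D_gen intro!: subspace_scale[OF ext_pow_subspace] ext_mon_Nil_in_pow)
  next
    case (Suc p)
    then obtain y ys where xs: "xs = y # ys" "length ys = Suc p" by (auto simp: length_Suc_conv)
    then show ?case
      using ext_mon_in_pow[of ys] ext_gen_mult_in_pow[OF Suc.IH[of ys], of y]
      by (simp add: D_mult subspace_diff[OF ext_pow_subspace] subspace_scale[OF ext_pow_subspace])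
  qed
  show "w \<in> ext_pow (Suc p) \<Longrightarrow> D x w \<in> ext_pow p"
    by (induction w rule: ext_pow_induct)
      (simp_all add: mon D_add D_scale subspace_add[OF ext_pow_subspace] subspace_scale[OF ext_pow_subspace])
qed

lemma D_pow_0: "w \<in> ext_pow 0 \<Longrightarrow> D x w = 0"
  using ext_pow_0 D_of_real by blast

text \<open>On \<open>ext_gen z * w\<close> the new terms
  \<open>B y z *\<^sub>R D x w - B x z *\<^sub>R D y w\<close> are antisymmetric in \<open>x\<close>
  and \<open>y\<close>, and the two signs from passing \<open>z\<close> cancel.\<close>

lemma D_anticomm: "D x (D y w) = - D y (D x w)"
proof (rule ext_linear_eqI[of "\<lambda>w. D x (D y w)" "\<lambda>w. - D y (D x w)"])
  show "D x (D y (ext_mon xs)) = - D y (D x (ext_mon xs))" for xs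
    by (induction xs) (simp_all add: D_1 D_0 D_mult D_diff D_scale)
qed (simp_all add: linear_iff D_add D_scale)

lemma D_sq: "D x (D x w) = 0"
  using D_anticomm[of x x w] by (metis eq_neg_iff_add_eq_0 real_vector.scale_zero_right
      scaleR_2 scaleR_eq_0_iff zero_neq_numeral)

definition Ds :: "'v list \<Rightarrow> 'v ext \<Rightarrow> 'v ext" where
  "Ds = foldr D"

lemma Ds_simps [simp]: "Ds [] w = w" "Ds (x # xs) w = D x (Ds xs w)" "Ds (xs @ ys) w = Ds xs (Ds ys w)"
  by (simp_all add: Ds_def)

lemma iterated_bracket_eq: "iterated_bracket B xs w = Ds xs w"
  by (simp add: iterated_bracket_def Ds_def D_def[abs_def])

lemma linear_Ds: "linear (Ds xs)"
proof (induction xs)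
  case (Cons x xs)
  then show ?case using linear_compose[OF Cons linear_D[of x]] by (simp add: o_def)
qed (simp add: linear_ident)

lemma Ds_in_pow: "w \<in> ext_pow (p + length xs) \<Longrightarrow> Ds xs w \<in> ext_pow p"
proof (induction xs arbitrary: p)
  case (Cons x xs)
  then show ?case using D_in_pow[of _ p] by simp
qed simp

text \<open>The contraction moves inwards, with a sign at each step, until it meets its own copy.
  This is why derived structures are alternating.\<close>

lemma Ds_mem: "x \<in> set xs \<Longrightarrow> D x (Ds xs w) = 0"
proof (induction xs)
  case (Cons y xs)
  then show ?case
    by (cases "x = y") (simp_all add: D_sq D_anticomm[of x y] D_0)
qed simp

lemma Ds_not_distinct: "\<not> distinct xs \<Longrightarrow> Ds xs w = 0"
  by (induction xs) (auto simp: Ds_mem D_0)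

lemma linear_Ds_update: "i < length xs \<Longrightarrow> linear (\<lambda>x. Ds (xs[i := x]) w)"
proof (induction xs arbitrary: i)
  case (Cons y xs)
  show ?case
  proof (cases i)
    case 0
    then show ?thesis by (simp add: linear_D_left)
  next
    case (Suc j)
    then show ?thesis
      using Cons linear_compose[OF Cons.IH[of j] linear_D[of y]] by (simp add: o_def)
  qed
qed simp

lemma ext_map_D:
  assumes "linear \<phi>" "\<And>x y. B (\<phi> x) (\<phi> y) = B x y"
  shows "ext_map \<phi> (D x w) = D (\<phi> x) (ext_map \<phi> w)"
proof (rule ext_linear_eqI[of "\<lambda>w. ext_map \<phi> (D x w)" "\<lambda>w. D (\<phi> x) (ext_map \<phi> w)"])
  note l = linear_ext_map[OF assms(1)]
  note [simp] = linear_add[OF l] linear_scale[OF l] linear_0[OF l] linear_diff[OF l] ext_map_1[OF assms(1)]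
    ext_map_mult[OF assms(1)] ext_map_gen[OF assms(1)]
  show "linear (\<lambda>w. ext_map \<phi> (D x w))" "linear (\<lambda>w. D (\<phi> x) (ext_map \<phi> w))"
    by (simp_all add: linear_iff D_add D_scale)
  show "ext_map \<phi> (D x (ext_mon xs)) = D (\<phi> x) (ext_map \<phi> (ext_mon xs))" for xs
    by (induction xs) (simp_all add: D_1 D_mult assms(2))
qed

lemma ext_map_Ds:
  assumes "linear \<phi>" "\<And>x y. B (\<phi> x) (\<phi> y) = B x y"
  shows "ext_map \<phi> (Ds xs w) = Ds (map \<phi> xs) (ext_map \<phi> w)"
  by (induction xs) (simp_all add: ext_map_D[OF assms])

end

section \<open>Orthonormal bases and the Hodge star\<close>

declare One_nat_def [simp del] upt_Suc [simp del]

locale orthonormal = symmetric_form B for B :: "'v::real_vector \<Rightarrow> 'v \<Rightarrow> real" +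
  fixes m :: nat and \<xi> :: "nat \<Rightarrow> 'v"
  assumes basis: "orthonormal_basis B m \<xi>"
begin

abbreviation onb :: "(nat \<Rightarrow> 'v) \<Rightarrow> bool" where "onb \<equiv> orthonormal_basis B m"

lemma onb_B:
  assumes "onb e" "i \<in> {1..m}" "j \<in> {1..m}"
  shows "B (e i) (e j) = (if i = j then 1 else 0)"
  using assms by (simp add: orthonormal_basis_def)

lemma onb_expand:
  assumes "onb e"
  shows "x = (\<Sum>i=1..m. B x (e i) *\<^sub>R e i)"
proof -
  have "(\<lambda>x. x) x = (\<lambda>x. \<Sum>i=1..m. B x (e i) *\<^sub>R e i) x"
  proof (rule linear_eq_on[of _ _ x "e ` {1..m}"])
    show "linear (\<lambda>x. \<Sum>i=1..m. B x (e i) *\<^sub>R e i)"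
      by (auto intro!: linearI simp: B_add B_scale scaleR_add_left sum.distrib scaleR_sum_right)
    show "x \<in> span (e ` {1..m})" using assms by (simp add: orthonormal_basis_def)
    fix b assume "b \<in> e ` {1..m}"
    then obtain j where j: "j \<in> {1..m}" "b = e j" by blast
    have "(\<Sum>i=1..m. B b (e i) *\<^sub>R e i) = (\<Sum>i=1..m. if i = j then e i else 0)"
      unfolding j(2) by (rule sum.cong) (use onb_B[OF assms j(1)] in auto)
    then show "b = (\<Sum>i=1..m. B b (e i) *\<^sub>R e i)" using j by simp
  qed (simp add: linear_ident)
  then show ?thesis .
qed

lemma onb_parseval:
  assumes "onb e"
  shows "B x y = (\<Sum>i=1..m. B x (e i) * B y (e i))"
proof -
  have "B x y = B x (\<Sum>i=1..m. B y (e i) *\<^sub>R e i)" using onb_expand[OF assms] by metis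
  then show ?thesis by (simp add: B_sum B_scale mult.commute)
qed

lemma onb_eq_0:
  assumes "onb e" "\<And>i. i \<in> {1..m} \<Longrightarrow> B x (e i) = 0"
  shows "x = 0"
  using onb_expand[OF assms(1), of x] assms(2) by simp

text \<open>A normalized orthogonal basis, with all squares equal to 1, makes the real form positive
  definite. The extremal arguments on unit vectors rest on this.\<close>

lemma B_pos: "0 \<le> B x x"
  unfolding onb_parseval[OF basis, of x x] by (intro sum_nonneg) simp

lemma B_eq_0: "B x x = 0 \<longleftrightarrow> x = 0"
proof
  assume "B x x = 0"
  then have "(\<Sum>i=1..m. B x (\<xi> i) * B x (\<xi> i)) = 0" using onb_parseval[OF basis, of x x] by simp
  then have "\<forall>i\<in>{1..m}. B x (\<xi> i) * B x (\<xi> i) = 0" by (subst (asm) sum_nonneg_eq_0_iff) auto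
  then show "x = 0" by (intro onb_eq_0[OF basis]) simp
qed (simp add: B_0)

lemma B_gt_0: "x \<noteq> 0 \<Longrightarrow> 0 < B x x"
  using B_pos[of x] B_eq_0[of x] by linarith

text \<open>Contracting with \<open>x - y\<close> itself turns a vanishing generator into
  \<open>B (x - y) (x - y) = 0\<close>. The embedding gives meaning to the unique vector in
  \<open>derived_structure\<close>.\<close>

lemma inj_ext_gen: "ext_gen x = ext_gen y \<longleftrightarrow> x = (y :: 'v)"
proof
  assume "ext_gen x = ext_gen y"
  then have "ext_gen (x - y) = 0" by (simp add: linear_diff[OF linear_ext_gen])
  then have "B (x - y) (x - y) *\<^sub>R (1 :: 'v ext) = 0" using D_gen D_0 by metis
  then show "x = y" using B_eq_0[of "x - y"] by simp
qed simp

text \<open>The operator on the left is an even derivation, since the sign of the contraction and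
  that of exchanging two generators cancel. By the expansion of \<open>x\<close> it fixes every
  generator, so it counts the degree.\<close>

lemma ext_euler:
  assumes "onb e" "w \<in> ext_pow p"
  shows "(\<Sum>i=1..m. ext_gen (e i) * D (e i) w) = real p *\<^sub>R w"
proof -
  have mon: "(\<Sum>i=1..m. ext_gen (e i) * D (e i) (ext_mon xs)) = real (length xs) *\<^sub>R ext_mon xs" for xs
  proof (induction xs)
    case (Cons x xs)
    let ?w = "ext_mon xs"
    have *: "ext_gen (e i) * D (e i) (ext_gen x * ?w)
        = ext_gen (B x (e i) *\<^sub>R e i) * ?w + ext_gen x * (ext_gen (e i) * D (e i) ?w)" for i
      by (simp add: D_mult right_diff_distrib mult.assoc[symmetric] ext_gen_anticomm[of x "e i"]
          ext_gen_scaleR sym[of x])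
    have "ext_gen x = (\<Sum>i=1..m. ext_gen (B x (e i) *\<^sub>R e i))"
      using arg_cong[OF onb_expand[OF assms(1), of x], of ext_gen] by (simp add: linear_sum[OF linear_ext_gen])
    then have "(\<Sum>i=1..m. ext_gen (B x (e i) *\<^sub>R e i) * ?w) = ext_gen x * ?w"
      by (simp add: sum_distrib_right)
    then have "(\<Sum>i=1..m. ext_gen (e i) * D (e i) (ext_gen x * ?w))
        = ext_gen x * ?w + ext_gen x * (real (length xs) *\<^sub>R ?w)"
      unfolding Cons[symmetric] by (simp add: * sum.distrib sum_distrib_left)
    then show ?case by (simp add: algebra_simps)
  qed (simp add: D_1)
  show ?thesis
    using assms(2)
  proof (induction w rule: ext_pow_induct)
    case (add a b)
    then show ?case by (simp add: D_add distrib_left sum.distrib scaleR_add_right)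
  next
    case (scale c a)
    then show ?case by (simp add: D_scale scaleR_sum_right[symmetric])
  qed (use mon in simp)
qed

text \<open>Euler's identity recovers \<open>w\<close> from its contractions after division by the
  degree, which must be positive: every contraction kills the scalars.\<close>

lemma D_all_0:
  assumes "w \<in> ext_pow (Suc p)" "\<And>x. D x w = 0"
  shows "w = 0"
  using ext_euler[OF basis assms(1)] by (simp add: assms(2))

text \<open>The induction splits off the last vector of the list because that one acts
  first.\<close>

lemma Ds_all_0:
  assumes "w \<in> ext_pow p" "\<And>xs. length xs = p \<Longrightarrow> Ds xs w = 0"
  shows "w = 0"
  using assms
proof (induction p arbitrary: w)
  case 0
  then show ?case using 0(2)[of "[]"] by simp
next
  case (Suc p)
  have "D x w = 0" for x
  proof (rule Suc.IH)
    show "D x w \<in> ext_pow p" using Suc.prems(1) by (rule D_in_pow)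
    show "Ds xs (D x w) = 0" if "length xs = p" for xs
      using Suc.prems(2)[of "xs @ [x]"] that by simp
  qed
  then show ?case by (rule D_all_0[OF Suc.prems(1)])
qed

definition L :: "'v ext" where "L = ext_mon (map \<xi> [1..<Suc m])"

abbreviation star :: "'v ext \<Rightarrow> 'v ext" where "star \<equiv> hodge_star B \<xi> m"

lemma linear_star: "linear star" and star_mon: "star (ext_mon xs) = Ds xs L"
  using is_hodge_star_hodge_star[OF bil sym, where \<xi> = \<xi> and m = m]
  unfolding is_hodge_star_def iterated_bracket_eq L_def by blast+

lemma star_1: "star 1 = L"
  using star_mon[of "[]"] by simp

lemma star_gen_mult: "star (ext_gen x * w) = D x (star w)"
proof (rule ext_linear_eqI[of "\<lambda>w. star (ext_gen x * w)" "\<lambda>w. D x (star w)"])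
  show "star (ext_gen x * ext_mon xs) = D x (star (ext_mon xs))" for xs
    using star_mon[of "x # xs"] by (simp add: star_mon)
qed (simp_all add: linear_iff linear_add[OF linear_star] linear_scale[OF linear_star] D_add D_scale
      distrib_left)

lemma gen_mult_L: "ext_gen x * L = 0"
proof -
  have "ext_gen x = (\<Sum>i=1..m. B x (\<xi> i) *\<^sub>R ext_gen (\<xi> i))"
    using arg_cong[OF onb_expand[OF basis, of x], of ext_gen]
    by (simp add: linear_sum[OF linear_ext_gen] ext_gen_scaleR)
  moreover have "ext_gen (\<xi> i) * L = 0" if "i \<in> {1..m}" for i
    unfolding L_def by (rule ext_gen_mult_mon_mem) (use that in \<open>auto\<close>)
  ultimately show ?thesis by (simp add: sum_distrib_right)
qed

text \<open>Dual to \<open>star_gen_mult\<close>: the star exchanges contraction and left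
  multiplication. On 1 the contraction vanishes, and so does the product of a vector with
  \<open>L\<close>.\<close>

lemma star_D: "star (D x w) = ext_gen x * star w"
proof (rule ext_linear_eqI[of "\<lambda>w. star (D x w)" "\<lambda>w. ext_gen x * star w"])
  show "star (D x (ext_mon xs)) = ext_gen x * star (ext_mon xs)" for xs
    by (induction xs)
      (simp_all add: D_1 star_1 linear_0[OF linear_star] gen_mult_L D_mult linear_diff[OF linear_star]
        linear_scale[OF linear_star] star_gen_mult sym[of x])
qed (simp_all add: linear_iff linear_add[OF linear_star] linear_scale[OF linear_star] D_add D_scale
      distrib_left)

text \<open>The sign of reversing \<open>m\<close> anticommuting factors; the exponent is
  \<open>m (m - 1) / 2\<close>.\<close>

definition \<sigma> :: real where "\<sigma> = (-1) ^ (\<Sum>i<m. i)"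

lemma \<sigma>_sq: "\<sigma> * \<sigma> = 1" and \<sigma>_nz: "\<sigma> \<noteq> 0"
  by (simp_all add: \<sigma>_def flip: power_add)

lemma Ds_orthonormal:
  assumes "sorted_wrt (\<lambda>x y. B x y = 0) xs" "\<forall>x\<in>set xs. B x x = 1"
  shows "Ds xs (ext_mon xs) = (-1) ^ (\<Sum>i<length xs. i) *\<^sub>R 1"
  using assms
proof (induction xs)
  case (Cons x xs)
  \<comment> \<open>Contractions by vectors orthogonal to \<open>x\<close> pass the generator of
    \<open>x\<close> with one sign each; this contributes the summand \<open>length xs\<close> to
    the exponent.\<close>
  have *: "Ds ys (ext_gen x * w) = (-1) ^ length ys *\<^sub>R (ext_gen x * Ds ys w)"
    if "\<forall>y\<in>set ys. B x y = 0" for ys w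
    using that by (induction ys) (simp_all add: D_scale D_mult sym[of x])
  from Cons have "Ds xs (ext_mon xs) = (-1) ^ (\<Sum>i<length xs. i) *\<^sub>R 1" by simp
  then show ?case
    using Cons.prems * by (simp add: D_scale D_gen power_add)
qed simp

lemma onb_Ds:
  assumes "onb e"
  shows "Ds (map e [1..<Suc m]) (ext_mon (map e [1..<Suc m])) = \<sigma> *\<^sub>R 1"
proof -
  have "sorted_wrt (\<lambda>x y. B x y = 0) (map e [1..<Suc m])"
    unfolding sorted_wrt_map
    by (rule sorted_wrt_mono_rel[OF _ sorted_wrt_upt]) (use onb_B[OF assms] in auto)
  moreover have "\<forall>x\<in>set (map e [1..<Suc m]). B x x = 1"
    using onb_B[OF assms] by (auto)
  ultimately show ?thesis using Ds_orthonormal[of "map e [1..<Suc m]"] by (simp add: \<sigma>_def)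
qed

lemma star_L: "star L = \<sigma> *\<^sub>R 1"
  using onb_Ds[OF basis] star_mon[of "map \<xi> [1..<Suc m]"] by (simp add: L_def)

text \<open>By the two exchange rules the square of the star commutes with left multiplication by
  generators, so it is determined by its value \<open>star L\<close> at 1.\<close>

lemma star_star: "star (star w) = \<sigma> *\<^sub>R w"
proof (rule ext_linear_eqI[of "\<lambda>w. star (star w)" "\<lambda>w. \<sigma> *\<^sub>R w"])
  show "star (star (ext_mon xs)) = \<sigma> *\<^sub>R ext_mon xs" for xs
    by (induction xs) (simp_all add: star_1 star_L star_gen_mult star_D)
qed (simp_all add: linear_iff linear_add[OF linear_star] linear_scale[OF linear_star] scaleR_add_right)

lemma star_inj: "star v = star w \<longleftrightarrow> v = w"
  using star_star \<sigma>_nz by (metis scaleR_left_imp_eq)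

lemma L_in_pow: "L \<in> ext_pow m"
  using ext_mon_in_pow[of "map \<xi> [1..<Suc m]"] by (simp add: L_def)

lemma star_in_pow: "w \<in> ext_pow p \<Longrightarrow> p \<le> m \<Longrightarrow> star w \<in> ext_pow (m - p)"
proof (induction w rule: ext_pow_induct)
  case (mon xs)
  then show ?case using Ds_in_pow[of L "m - p" xs] L_in_pow by (simp add: star_mon)
qed (simp_all add: linear_add[OF linear_star] linear_scale[OF linear_star]
    subspace_add[OF ext_pow_subspace] subspace_scale[OF ext_pow_subspace])

text \<open>The star carries degree \<open>m\<close> to the scalars, and its square is invertible;
  so every element of top degree is a multiple of \<open>star 1\<close>.\<close>

lemma top_degree: "w \<in> ext_pow m \<Longrightarrow> \<exists>c. w = c *\<^sub>R L"
proof -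
  assume "w \<in> ext_pow m"
  then have "star w \<in> ext_pow 0" using star_in_pow[of w m] by simp
  then obtain c where "star w = of_real c" using ext_pow_0 by blast
  then have "star (star w) = c *\<^sub>R L"
    by (simp add: of_real_def linear_scale[OF linear_star] star_1)
  then have "w = (\<sigma> * c) *\<^sub>R L" unfolding star_star using \<sigma>_sq
    by (metis scaleR_one scaleR_scaleR)
  then show ?thesis ..
qed

text \<open>Contracting the product of the \<open>e i\<close> with their own list gives
  \<open>\<sigma>\<close> directly and \<open>d * d * \<sigma>\<close> through \<open>L\<close>. The
  two outcomes are the two orientations.\<close>

lemma onb_volume:
  assumes "onb e"
  obtains "ext_mon (map e [1..<Suc m]) = L" | "ext_mon (map e [1..<Suc m]) = - L"
proof -
  let ?es = "map e [1..<Suc m]"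
  obtain d where d: "ext_mon ?es = d *\<^sub>R L"
    using top_degree ext_mon_in_pow[of ?es] by force
  have "\<sigma> *\<^sub>R (1 :: 'v ext) = d *\<^sub>R Ds ?es L"
    using onb_Ds[OF assms] by (simp only: d linear_scale[OF linear_Ds])
  also have "\<dots> = (d * d * \<sigma>) *\<^sub>R 1"
    unfolding star_mon[symmetric] d by (simp add: linear_scale[OF linear_star] star_L)
  finally have "d * d = 1" using \<sigma>_nz by simp
  then have "d = 1 \<or> d = - 1" by (simp add: square_eq_1_iff)
  then show ?thesis using d that by auto
qed

section \<open>Alternating forms as elements of the exterior algebra\<close>

definition is_form :: "nat \<Rightarrow> ('v list \<Rightarrow> real) \<Rightarrow> bool" where
  "is_form p \<omega> \<longleftrightarrow>
     (\<forall>as i. length as = p \<longrightarrow> i < p \<longrightarrow> linear (\<lambda>x. \<omega> (as[i := x]))) \<and>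
     (\<forall>as. length as = p \<longrightarrow> \<not> distinct as \<longrightarrow> \<omega> as = 0)"

lemma is_form_snoc_linear:
  assumes "is_form (Suc p) \<omega>" "length as = p"
  shows "linear (\<lambda>x. \<omega> (as @ [x]))"
proof -
  have "linear (\<lambda>x. \<omega> ((as @ [0])[p := x]))"
    using assms unfolding is_form_def by (metis length_append_singleton lessI)
  then show ?thesis by (simp add: assms(2)[symmetric])
qed

lemma is_form_snoc:
  assumes "is_form (Suc p) \<omega>"
  shows "is_form p (\<lambda>as. \<omega> (as @ [x]))"
  unfolding is_form_def
proof (intro conjI allI impI)
  fix as :: "'v list" and i assume "length as = p" "i < p"
  then have "linear (\<lambda>y. \<omega> ((as @ [x])[i := y]))"
    using assms unfolding is_form_def by (metis length_append_singleton less_SucI)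
  then show "linear (\<lambda>y. \<omega> (as[i := y] @ [x]))"
    using \<open>length as = p\<close> \<open>i < p\<close> by (simp add: list_update_append)
next
  fix as :: "'v list" assume "length as = p" "\<not> distinct as"
  then show "\<omega> (as @ [x]) = 0" using assms unfolding is_form_def by simp
qed

lemma is_form_swap:
  assumes "is_form (Suc (Suc q)) \<omega>" "length bs = q"
  shows "\<omega> (bs @ [y, x]) = - \<omega> (bs @ [x, y])"
proof -
  have l1: "linear (\<lambda>y. \<omega> (bs @ [x, y]))" for x
    using is_form_snoc_linear[OF assms(1), of "bs @ [x]"] assms(2) by simp
  have l2: "linear (\<lambda>x. \<omega> (bs @ [x, y]))" for y
    using is_form_snoc_linear[OF is_form_snoc[OF assms(1)], of bs y] assms(2) by simp
  have z: "\<omega> (bs @ [z, z]) = 0" for z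
    using assms unfolding is_form_def by simp
  have "\<omega> (bs @ [x + y, x + y]) = \<omega> (bs @ [x, x]) + \<omega> (bs @ [x, y]) + (\<omega> (bs @ [y, x]) + \<omega> (bs @ [y, y]))"
    by (simp add: linear_add[OF l1] linear_add[OF l2])
  then show ?thesis by (simp add: z)
qed

lemma of_real_in_pow_0: "of_real c \<in> ext_pow 0"
  by (simp add: of_real_def subspace_scale[OF ext_pow_subspace] ext_mon_Nil_in_pow)

text \<open>If \<open>M x\<close> is to be the contraction of \<open>\<mu>\<close> with
  \<open>x\<close>, Euler's identity in degree \<open>Suc p\<close> leaves only one candidate for
  \<open>\<mu>\<close>. The last argument is frozen because \<open>Ds\<close> applies it
  first.\<close>

lemma is_form_potential:
  assumes "is_form p \<omega>"
  shows "\<exists>\<mu>\<in>ext_pow p. \<forall>as. length as = p \<longrightarrow> Ds as \<mu> = of_real (\<omega> as)"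
  using assms
proof (induction p arbitrary: \<omega>)
  case 0
  show ?case by (rule bexI[of _ "of_real (\<omega> [])"]) (simp_all add: of_real_in_pow_0)
next
  case (Suc p)
  have "\<forall>x. \<exists>\<mu>\<in>ext_pow p. \<forall>as. length as = p \<longrightarrow> Ds as \<mu> = of_real (\<omega> (as @ [x]))"
    using Suc.IH[OF is_form_snoc[OF Suc.prems]] by blast
  then obtain M where M: "\<And>x. M x \<in> ext_pow p"
    and Ds_M: "\<And>x as. length as = p \<Longrightarrow> Ds as (M x) = of_real (\<omega> (as @ [x]))"
    by metis
  \<comment> \<open>\<open>M\<close> comes from pointwise choice, but potentials are unique by
    \<open>Ds_all_0\<close>, so it inherits linearity from the last argument of
    \<open>\<omega>\<close>.\<close>
  have M_expand: "M y = (\<Sum>i=1..m. B y (\<xi> i) *\<^sub>R M (\<xi> i))" for y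
  proof -
    have "M y - (\<Sum>i=1..m. B y (\<xi> i) *\<^sub>R M (\<xi> i)) = 0"
    proof (rule Ds_all_0)
      show "M y - (\<Sum>i=1..m. B y (\<xi> i) *\<^sub>R M (\<xi> i)) \<in> ext_pow p"
        by (intro subspace_diff subspace_sum subspace_scale ext_pow_subspace M)
      fix as :: "'v list" assume as: "length as = p"
      note l = is_form_snoc_linear[OF Suc.prems as]
      have "\<omega> (as @ [y]) = \<omega> (as @ [\<Sum>i=1..m. B y (\<xi> i) *\<^sub>R \<xi> i])"
        using arg_cong[OF onb_expand[OF basis, of y], of "\<lambda>y. \<omega> (as @ [y])"] .
      also have "\<dots> = (\<Sum>i=1..m. B y (\<xi> i) * \<omega> (as @ [\<xi> i]))"
        by (simp add: linear_sum[OF l] linear_scale[OF l])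
      finally show "Ds as (M y - (\<Sum>i=1..m. B y (\<xi> i) *\<^sub>R M (\<xi> i))) = 0"
        by (simp add: linear_diff[OF linear_Ds] linear_sum[OF linear_Ds] linear_scale[OF linear_Ds]
            Ds_M[OF as] of_real_def scaleR_sum_left)
    qed
    then show ?thesis by simp
  qed
  \<comment> \<open>The compatibility of the family \<open>M\<close>, expressing alternation in the
    last two arguments. For \<open>p = 0\<close> both sides contract scalars.\<close>
  have D_M: "D y (M x) = - D x (M y)" for x y
  proof (cases p)
    case 0
    then show ?thesis using M D_pow_0 by simp
  next
    case (Suc q)
    have "D y (M x) + D x (M y) = 0"
    proof (rule Ds_all_0)
      show "D y (M x) + D x (M y) \<in> ext_pow q"
        using M D_in_pow unfolding Suc by (intro subspace_add ext_pow_subspace) auto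
      fix bs :: "'v list" assume bs: "length bs = q"
      have "Ds bs (D y (M x)) = of_real (\<omega> (bs @ [y, x]))" for x y
        using Ds_M[of "bs @ [y]" x] bs Suc by simp
      then show "Ds bs (D y (M x) + D x (M y)) = 0"
        using is_form_swap[OF Suc.prems[unfolded Suc] bs, of y x]
        by (simp add: linear_add[OF linear_Ds])
    qed
    then show ?thesis by (simp add: add_eq_0_iff)
  qed
  define \<mu> where "\<mu> = (1 / real (Suc p)) *\<^sub>R (\<Sum>i=1..m. ext_gen (\<xi> i) * M (\<xi> i))"
  have D_\<mu>: "D y \<mu> = M y" for y
  proof -
    \<comment> \<open>Passing \<open>\<xi> i\<close> costs a sign that \<open>D_M\<close> returns.
      The first terms add up to \<open>M y\<close>, the second to an Euler sum, which is
      \<open>p\<close> times \<open>M y\<close>.\<close>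
    have "D y (ext_gen (\<xi> i) * M (\<xi> i)) = B y (\<xi> i) *\<^sub>R M (\<xi> i) + ext_gen (\<xi> i) * D (\<xi> i) (M y)" for i
      by (simp add: D_mult D_M[of y "\<xi> i"])
    then have "D y (\<Sum>i=1..m. ext_gen (\<xi> i) * M (\<xi> i)) = M y + real p *\<^sub>R M y"
      by (simp add: D_sum sum.distrib ext_euler[OF basis M] M_expand[of y, symmetric])
    also have "\<dots> = real (Suc p) *\<^sub>R M y" by (simp add: algebra_simps)
    finally show ?thesis by (simp add: \<mu>_def D_scale)
  qed
  show ?case
  proof (intro bexI[of _ \<mu>] allI impI)
    show "\<mu> \<in> ext_pow (Suc p)"
      unfolding \<mu>_def by (intro subspace_scale subspace_sum ext_pow_subspace ext_gen_mult_in_pow M)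
    fix as :: "'v list" assume "length as = Suc p"
    then obtain bs y where "as = bs @ [y]" "length bs = p"
      by (metis length_Suc_conv_rev)
    then show "Ds as \<mu> = of_real (\<omega> as)" by (simp add: D_\<mu> Ds_M)
  qed
qed

section \<open>Invariant structures and their derived potentials\<close>

lemma derived_structure_eq:
  assumes "\<mu> \<in> ext_pow (Suc n)" "length as = n"
  shows "ext_gen (derived_structure B n \<mu> as) = Ds as \<mu>"
proof -
  have "Ds as \<mu> \<in> ext_pow 1" using assms by (intro Ds_in_pow) (simp flip: Suc_eq_plus1_left)
  then obtain x where x: "ext_gen x = Ds as \<mu>" using ext_pow_1 by metis
  moreover have "(THE v. ext_gen v = Ds as \<mu>) = x"
    by (rule the_equality) (simp_all add: x[symmetric] inj_ext_gen)
  ultimately show ?thesis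
    using assms(2) by (simp add: derived_structure_def iterated_bracket_eq)
qed

lemma B_derived_structure:
  assumes "\<mu> \<in> ext_pow (Suc n)" "length as = n"
  shows "B x (derived_structure B n \<mu> as) *\<^sub>R 1 = Ds (x # as) \<mu>"
  by (simp add: derived_structure_eq[OF assms, symmetric] D_gen)

text \<open>Pairing with a vector is one more contraction, so invariance is the anticommutation of
  the two outermost ones.\<close>

lemma derived_structure_invariant:
  assumes \<mu>: "\<mu> \<in> ext_pow (Suc n)"
  shows "derived_structure B n \<mu> \<in> invariant_structures B n"
proof -
  let ?f = "derived_structure B n \<mu>"
  note e = derived_structure_eq[OF \<mu>]
  have "linear (\<lambda>x. ?f (as[i := x]))" if "length as = n" "i < n" for as i
  proof -
    have l: "linear (\<lambda>x. Ds (as[i := x]) \<mu>)" using that by (intro linear_Ds_update) simp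
    show ?thesis
    proof (rule linearI)
      show "?f (as[i := x + y]) = ?f (as[i := x]) + ?f (as[i := y])" for x y
        using that by (subst inj_ext_gen[symmetric]) (simp add: e ext_gen_add linear_add[OF l])
      show "?f (as[i := c *\<^sub>R x]) = c *\<^sub>R ?f (as[i := x])" for x c
        using that by (subst inj_ext_gen[symmetric]) (simp add: e ext_gen_scaleR linear_scale[OF l])
    qed
  qed
  moreover have "?f as = 0" if "length as = n" "\<not> distinct as" for as
    using that by (subst inj_ext_gen[symmetric]) (simp add: e linear_0[OF linear_ext_gen] Ds_not_distinct)
  moreover have "B x (?f (y # as)) = - B y (?f (x # as))" if "Suc (length as) = n" for x y as
  proof -
    have "B x (?f (y # as)) *\<^sub>R (1 :: 'v ext) = (- B y (?f (x # as))) *\<^sub>R 1"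
      using that D_anticomm[of x y "Ds as \<mu>"]
      by (simp only: B_derived_structure[OF \<mu>] length_Cons scaleR_minus_left Ds_simps)
    then show ?thesis by (simp only: scaleR_cancel_right) simp
  qed
  moreover have "?f \<in> extensional {as. length as = n}"
    by (simp add: derived_structure_def)
  ultimately show ?thesis
    unfolding invariant_structures_def multilinear_on_lists_def alternating_on_lists_def by blast
qed

lemma derived_structure_inj:
  assumes "\<mu> \<in> ext_pow (Suc n)" "\<nu> \<in> ext_pow (Suc n)"
    and eq: "\<And>as. length as = n \<Longrightarrow> derived_structure B n \<mu> as = derived_structure B n \<nu> as"
  shows "\<mu> = \<nu>"
proof -
  have "\<mu> - \<nu> = 0"
  proof (rule Ds_all_0)
    show "\<mu> - \<nu> \<in> ext_pow (Suc n)" using assms by (intro subspace_diff ext_pow_subspace)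
    fix xs :: "'v list" assume "length xs = Suc n"
    then obtain x as where "xs = x # as" "length as = n" by (auto simp: length_Suc_conv)
    then show "Ds xs (\<mu> - \<nu>) = 0"
      using eq[of as] derived_structure_eq[OF assms(1), of as] derived_structure_eq[OF assms(2), of as]
      by (simp add: linear_diff[OF linear_Ds] D_0)
  qed
  then show ?thesis by simp
qed

text \<open>The form \<open>\<omega>\<close> puts the paired vector in front. Invariance makes it
  antisymmetric in its first two arguments, the structure makes it alternating in all but the first;
  together they make it an alternating form.\<close>

lemma derived_structure_surj:
  assumes f: "f \<in> invariant_structures B n"
  shows "\<exists>\<mu>\<in>ext_pow (Suc n). f = derived_structure B n \<mu>"
proof -
  have ext: "f \<in> extensional {as. length as = n}"
    and lin: "\<And>as i. length as = n \<Longrightarrow> i < n \<Longrightarrow> linear (\<lambda>x. f (as[i := x]))"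
    and alt: "\<And>as. length as = n \<Longrightarrow> \<not> distinct as \<Longrightarrow> f as = 0"
    and inv: "\<And>x y as. Suc (length as) = n \<Longrightarrow> B x (f (y # as)) = - B y (f (x # as))"
    using f unfolding invariant_structures_def multilinear_on_lists_def alternating_on_lists_def
    by blast+
  define \<omega> where "\<omega> as = B (hd as) (f (tl as))" for as
  have "is_form (Suc n) \<omega>"
    unfolding is_form_def
  proof (intro conjI allI impI)
    fix as :: "'v list" and i assume as: "length as = Suc n" "i < Suc n"
    then obtain a bs where bs: "as = a # bs" "length bs = n" by (auto simp: length_Suc_conv)
    show "linear (\<lambda>x. \<omega> (as[i := x]))"
    proof (cases i)
      case 0
      then show ?thesis by (simp add: bs \<omega>_def linear_B)
    next
      case (Suc j)
      then show ?thesis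
        using linear_compose[OF lin[OF bs(2), of j] linear_B(1)[of a]] as
        by (simp add: bs \<omega>_def o_def)
    qed
  next
    fix as :: "'v list" assume as: "length as = Suc n" "\<not> distinct as"
    then obtain a bs where bs: "as = a # bs" "length bs = n" by (auto simp: length_Suc_conv)
    show "\<omega> as = 0"
    proof (cases "distinct bs")
      case False
      then show ?thesis by (simp add: bs \<omega>_def alt B_0)
    next
      case True
      then have "a \<in> set bs" using as bs by simp
      \<comment> \<open>One use of invariance moves a repetition of the first entry behind it,
        unless the second entry is the copy; then the value equals its own negative.\<close>
      then obtain b cs where cs: "bs = b # cs" by (cases bs) auto
      then have swap: "B a (f bs) = - B b (f (a # cs))"
        using inv[of cs a b] bs(2) by simp
      show ?thesis
      proof (cases "a = b")
        case True
        then show ?thesis using swap by (simp add: \<omega>_def bs cs)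
      next
        case False
        then have "f (a # cs) = 0" using alt[of "a # cs"] \<open>a \<in> set bs\<close> bs cs by simp
        then show ?thesis using swap by (simp add: \<omega>_def bs B_0)
      qed
    qed
  qed
  then obtain \<mu> where \<mu>: "\<mu> \<in> ext_pow (Suc n)"
    and D\<mu>: "\<And>as. length as = Suc n \<Longrightarrow> Ds as \<mu> = of_real (\<omega> as)"
    using is_form_potential by blast
  have "f = derived_structure B n \<mu>"
  proof (rule extensionalityI[OF ext])
    show "derived_structure B n \<mu> \<in> extensional {as. length as = n}"
      by (simp add: derived_structure_def)
    fix as :: "'v list" assume "as \<in> {as. length as = n}"
    then have as: "length as = n" by simp
    let ?g = "derived_structure B n \<mu>"
    have "f as - ?g as = 0"
    proof (rule onb_eq_0[OF basis])
      fix i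
      have "B (\<xi> i) (?g as) *\<^sub>R 1 = (of_real (B (\<xi> i) (f as)) :: 'v ext)"
        unfolding B_derived_structure[OF \<mu> as] using D\<mu>[of "\<xi> i # as"] as by (simp add: \<omega>_def)
      then have "B (\<xi> i) (?g as) = B (\<xi> i) (f as)" by (simp add: of_real_def)
      then show "B (f as - ?g as) (\<xi> i) = 0" by (simp add: B_diff sym[of _ "\<xi> i"])
    qed
    then show "f as = ?g as" by simp
  qed
  then show ?thesis using \<mu> by blast
qed

lemma derived_structure_map:
  assumes \<mu>: "\<mu> \<in> ext_pow (Suc n)" and \<phi>: "linear \<phi>" "\<And>x y. B (\<phi> x) (\<phi> y) = B x y"
    and as: "length as = n"
  shows "derived_structure B n (ext_map \<phi> \<mu>) (map \<phi> as) = \<phi> (derived_structure B n \<mu> as)"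
  using derived_structure_eq[OF ext_map_in_pow[OF \<phi>(1) \<mu>], of "map \<phi> as"] as
    derived_structure_eq[OF \<mu> as] ext_map_Ds[OF \<phi>, of as \<mu>] ext_map_gen[OF \<phi>(1)]
  by (metis inj_ext_gen length_map)

end

section \<open>Orthonormal systems and linear conditions\<close>

context orthonormal
begin

lemma finite_basis: "independent (\<xi> ` {1..m})" "span (\<xi> ` {1..m}) = UNIV" "card (\<xi> ` {1..m}) = m"
  using basis by (auto simp: orthonormal_basis_def card_image)

lemma orthonormal_independent:
  assumes "finite I" and "\<And>i j. i \<in> I \<Longrightarrow> j \<in> I \<Longrightarrow> B (e i) (e j) = (if i = j then 1 else 0)"
  shows "inj_on e I" "independent (e ` I)"
proof -
  show inj: "inj_on e I"
    by (rule inj_onI) (metis assms(2) zero_neq_one)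
  show "independent (e ` I)"
  proof (rule independent_if_scalars_zero)
    fix c x assume 0: "(\<Sum>x\<in>e ` I. c x *\<^sub>R x) = 0" and "x \<in> e ` I"
    then obtain j where j: "j \<in> I" "x = e j" by blast
    have "0 = (\<Sum>i\<in>I. c (e i) * B (e j) (e i))"
      using arg_cong[OF 0, of "B (e j)"] by (simp add: B_0 B_sum B_scale sum.reindex[OF inj])
    also have "\<dots> = (\<Sum>i\<in>I. if i = j then c (e i) else 0)"
      by (rule sum.cong) (use assms(2) j in auto)
    finally show "c x = 0" using j assms(1) by simp
  qed (use assms(1) in simp)
qed

text \<open>The system extends to a maximal independent set, which has at most \<open>m\<close>
  elements, so nothing was added.\<close>

lemma onbI:
  assumes "\<And>i j. i \<in> {1..m} \<Longrightarrow> j \<in> {1..m} \<Longrightarrow> B (e i) (e j) = (if i = j then 1 else 0)"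
  shows "onb e"
proof -
  note e = orthonormal_independent[OF _ assms, of "{1..m}"]
  obtain T where T: "e ` {1..m} \<subseteq> T" "independent T" "UNIV \<subseteq> span T"
    using maximal_independent_subset_extend[of "e ` {1..m}" UNIV] e by auto
  then have "finite T" "card T \<le> m"
    using independent_span_bound[of "\<xi> ` {1..m}" T] finite_basis by auto
  moreover have "card (e ` {1..m}) = m" using e by (simp add: card_image)
  ultimately have "e ` {1..m} = T" using T by (intro card_seteq) auto
  then show ?thesis using T e assms by (auto simp: orthonormal_basis_def)
qed

text \<open>There are more independent vectors than linear conditions. The values of the conditions
  are gathered as coefficients on the first \<open>r\<close> basis vectors, hence
  \<open>r \<le> m\<close>, and a dimension count forbids this map to be injective on the
  span.\<close>

lemma exists_orthogonal:
  assumes "independent S" "r < card S" "r \<le> m"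
  obtains x where "x \<in> span S" "x \<noteq> 0" "\<And>j. j \<in> {1..r} \<Longrightarrow> B x (f j) = 0"
proof -
  define T where "T x = (\<Sum>j=1..r. B x (f j) *\<^sub>R \<xi> j)" for x
  have T: "linear T"
    unfolding T_def
    by (auto intro!: linearI simp: B_add B_scale scaleR_add_left sum.distrib scaleR_sum_right)
  have "\<not> inj_on T (span S)"
  proof
    assume inj: "inj_on T (span S)"
    then have ind: "independent (T ` S)"
      using linear_independent_injective_image[OF T assms(1)] by blast
    have "T ` S \<subseteq> span (\<xi> ` {1..r})"
      unfolding T_def by (intro image_subsetI span_sum span_scale span_base imageI)
    then have "card (T ` S) \<le> card (\<xi> ` {1..r})"
      using independent_span_bound[OF _ ind] by simp
    also have "\<dots> \<le> r" using card_image_le[of "{1..r}" \<xi>] by simp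
    finally show False
      using assms(2) card_image[OF inj_on_subset[OF inj span_superset]] by simp
  qed
  then obtain x where x: "x \<in> span S" "x \<noteq> 0" "T x = 0"
    using linear_inj_on_span_iff_independent_image linear_injective_on_subspace_0[OF T subspace_span, of S]
    by blast
  have "B x (f i) = 0" if "i \<in> {1..r}" for i
  proof -
    have "0 = (\<Sum>j=1..r. B x (f j) * B (\<xi> i) (\<xi> j))"
      using arg_cong[OF x(3), of "B (\<xi> i)"] by (simp add: T_def B_0 B_sum B_scale)
    also have "\<dots> = (\<Sum>j=1..r. if j = i then B x (f j) else 0)"
      by (rule sum.cong) (use onb_B[OF basis] that assms(3) in auto)
    finally show ?thesis using that by simp
  qed
  then show ?thesis using x that by blast
qed

section \<open>The special orthogonal group\<close>

text \<open>The determinant as a function of the list of columns, to which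
  \<open>is_form_potential\<close> applies.\<close>

definition det_form :: "'v list \<Rightarrow> real" where
  "det_form as = Determinant.det (mat m m (\<lambda>(i, j). representation (\<xi> ` {1..m}) (as ! j) (\<xi> (Suc i))))"

lemma is_form_det_form: "is_form m det_form"
  unfolding is_form_def
proof (intro conjI allI impI)
  let ?r = "\<lambda>x i. representation (\<xi> ` {1..m}) x (\<xi> (Suc i))"
  fix as :: "'v list" and k assume as: "length as = m" "k < m"
  define A where "A x = mat m m (\<lambda>(i, j). ?r (as[k := x] ! j) i)" for x
  define c where "c i = cofactor (A 0) i k" for i
  \<comment> \<open>The cofactors of column \<open>k\<close> do not see that column, so the Laplace
    expansion along it is linear in \<open>x\<close>.\<close>
  have "cofactor (A x) i k = c i" for x i
  proof -
    have "mat_delete (A x) i k = mat_delete (A 0) i k"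
      by (rule eq_matI) (use as in \<open>auto simp: mat_delete_def A_def\<close>)
    then show ?thesis by (simp add: cofactor_def c_def)
  qed
  moreover have "det_form (as[k := x]) = (\<Sum>i<m. A x $$ (i, k) * cofactor (A x) i k)" for x
    unfolding det_form_def A_def[symmetric]
    by (rule laplace_expansion_column) (use as in \<open>simp_all add: A_def\<close>)
  ultimately have "det_form (as[k := x]) = (\<Sum>i<m. ?r x i * c i)" for x
    using as by (simp add: A_def)
  then show "linear (\<lambda>x. det_form (as[k := x]))"
    using finite_basis
    by (auto intro!: linearI simp: representation_add representation_scale sum_distrib_left
        sum.distrib algebra_simps)
next
  fix as :: "'v list" assume as: "length as = m" "\<not> distinct as"
  then obtain i j where ij: "i < m" "j < m" "i \<noteq> j" "as ! i = as ! j"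
    by (auto simp: distinct_conv_nth)
  show "det_form as = 0"
    unfolding det_form_def
    by (rule det_identical_columns[OF _ ij(3,1,2)])
      (use ij in \<open>auto intro!: eq_vecI\<close>)
qed

lemma det_form_map: "det_form (map (\<lambda>i. \<phi> (\<xi> i)) [1..<Suc m]) = operator_det \<xi> m \<phi>"
  unfolding det_form_def operator_det_def
  by (rule arg_cong[of _ _ Determinant.det], rule eq_matI) (auto simp: nth_upt simp flip: Suc_eq_plus1_left)

lemma operator_det_id: "operator_det \<xi> m (\<lambda>x. x) = 1"
proof -
  have "mat m m (\<lambda>(i, j). representation (\<xi> ` {1..m}) (\<xi> (Suc j)) (\<xi> (Suc i))) = (1\<^sub>m m :: real mat)"
  proof (rule eq_matI)
    fix i j assume "i < dim_row (1\<^sub>m m :: real mat)" "j < dim_col (1\<^sub>m m :: real mat)"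
    then have ij: "i < m" "j < m" by simp_all
    then have "\<xi> (Suc j) \<in> \<xi> ` {1..m}" by auto
    moreover have "\<xi> (Suc i) = \<xi> (Suc j) \<longleftrightarrow> i = j"
      using basis ij by (auto simp: orthonormal_basis_def dest: inj_onD)
    ultimately show "mat m m (\<lambda>(i, j). representation (\<xi> ` {1..m}) (\<xi> (Suc j)) (\<xi> (Suc i))) $$ (i, j)
        = (1\<^sub>m m :: real mat) $$ (i, j)"
      using ij representation_basis[OF finite_basis(1)] by (auto simp: one_mat_def)
  qed simp_all
  then show ?thesis by (simp add: operator_det_def)
qed

text \<open>Both sides are multiples of the alternating form \<open>as \<mapsto> Ds as L\<close>, as alternating \<open>m\<close>-forms are
  unique up to a factor.\<close>

lemma operator_det_star:
  assumes "linear \<phi>"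
  shows "operator_det \<xi> m \<phi> *\<^sub>R 1 = \<sigma> *\<^sub>R star (ext_map \<phi> L)"
proof -
  obtain \<mu> where \<mu>: "\<mu> \<in> ext_pow m" "\<And>as. length as = m \<Longrightarrow> Ds as \<mu> = of_real (det_form as)"
    using is_form_potential[OF is_form_det_form] by blast
  obtain c where c: "\<mu> = c *\<^sub>R L" using top_degree[OF \<mu>(1)] by blast
  have det: "det_form as *\<^sub>R 1 = c *\<^sub>R Ds as L" if "length as = m" for as
    using \<mu>(2)[OF that] by (simp add: c linear_scale[OF linear_Ds] of_real_def)
  \<comment> \<open>The factor \<open>c\<close> is found at the basis itself, where the determinant
    is 1 and the contraction gives \<open>\<sigma>\<close>.\<close>
  have "(1::real) *\<^sub>R (1 :: 'v ext) = (c * \<sigma>) *\<^sub>R 1"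
    using det[of "map \<xi> [1..<Suc m]"] det_form_map[of "\<lambda>x. x"] onb_Ds[OF basis]
    by (simp add: L_def operator_det_id)
  then have "c * \<sigma> = 1" by (simp only: scaleR_cancel_right) simp
  then have "c = \<sigma>" using \<sigma>_sq \<sigma>_nz by (metis mult_right_cancel)
  moreover have "star (ext_map \<phi> L) = Ds (map (\<lambda>i. \<phi> (\<xi> i)) [1..<Suc m]) L"
  proof -
    have "ext_map \<phi> L = ext_mon (map (\<lambda>i. \<phi> (\<xi> i)) [1..<Suc m])"
      using ext_map_mon[OF assms, of "map \<xi> [1..<Suc m]"] by (simp add: L_def o_def)
    then show ?thesis by (simp only: star_mon)
  qed
  ultimately show ?thesis
    using det[of "map (\<lambda>i. \<phi> (\<xi> i)) [1..<Suc m]"] by (simp add: det_form_map)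
qed

abbreviation SO :: "('v \<Rightarrow> 'v) set" where "SO \<equiv> special_orthogonal B \<xi> m"

text \<open>The determinant is the factor by which \<open>ext_map \<phi>\<close> scales
  \<open>L\<close>. From here on membership is a condition that composition and inversion visibly
  respect.\<close>

lemma SO_iff:
  "\<phi> \<in> SO \<longleftrightarrow> linear \<phi> \<and> (\<forall>x y. B (\<phi> x) (\<phi> y) = B x y) \<and> ext_map \<phi> L = L"
proof -
  have "operator_det \<xi> m \<phi> = 1 \<longleftrightarrow> ext_map \<phi> L = L" if "linear \<phi>"
  proof
    assume "ext_map \<phi> L = L"
    then have "operator_det \<xi> m \<phi> *\<^sub>R (1 :: 'v ext) = 1 *\<^sub>R 1"
      using operator_det_star[OF that] \<sigma>_sq by (simp add: star_L)
    then show "operator_det \<xi> m \<phi> = 1" by (simp only: scaleR_cancel_right) simp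
  next
    assume "operator_det \<xi> m \<phi> = 1"
    then have "\<sigma> *\<^sub>R star (ext_map \<phi> L) = \<sigma> *\<^sub>R star L"
      using operator_det_star[OF that] \<sigma>_sq by (simp add: star_L)
    then show "ext_map \<phi> L = L" using \<sigma>_nz by (simp add: star_inj)
  qed
  then show ?thesis by (auto simp: special_orthogonal_def)
qed

lemma SO_D:
  assumes "\<phi> \<in> SO"
  shows "linear \<phi>" "B (\<phi> x) (\<phi> y) = B x y" "ext_map \<phi> L = L"
  using assms by (simp_all add: SO_iff)

lemma SO_id: "(\<lambda>x. x) \<in> SO"
  by (simp add: SO_iff linear_ident ext_map_id)

lemma SO_comp: "\<phi> \<in> SO \<Longrightarrow> \<psi> \<in> SO \<Longrightarrow> (\<lambda>x. \<psi> (\<phi> x)) \<in> SO"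
  using linear_compose[of \<phi> \<psi>] by (simp add: SO_iff ext_map_comp o_def)

definition frame_map :: "(nat \<Rightarrow> 'v) \<Rightarrow> 'v \<Rightarrow> 'v" where
  "frame_map e x = (\<Sum>i=1..m. B x (\<xi> i) *\<^sub>R e i)"

lemma frame_map:
  assumes "onb e"
  shows "linear (frame_map e)" "B (frame_map e x) (frame_map e y) = B x y"
    "i \<in> {1..m} \<Longrightarrow> frame_map e (\<xi> i) = e i"
    "ext_map (frame_map e) L = ext_mon (map e [1..<Suc m])"
proof -
  show lin: "linear (frame_map e)"
    unfolding frame_map_def
    by (auto intro!: linearI simp: B_add B_scale scaleR_add_left sum.distrib scaleR_sum_right)
  show \<xi>: "frame_map e (\<xi> i) = e i" if "i \<in> {1..m}" for i
  proof -
    have "frame_map e (\<xi> i) = (\<Sum>j=1..m. if j = i then e j else 0)"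
      unfolding frame_map_def by (rule sum.cong) (use onb_B[OF basis] that in auto)
    then show ?thesis using that by simp
  qed
  have *: "B (frame_map e x) (e i) = B x (\<xi> i)" if "i \<in> {1..m}" for i x
  proof -
    have "B (frame_map e x) (e i) = (\<Sum>j=1..m. if j = i then B x (\<xi> j) else 0)"
      unfolding frame_map_def B_sum B_scale by (rule sum.cong) (use onb_B[OF assms] that in auto)
    then show ?thesis using that by simp
  qed
  have "B (frame_map e x) (frame_map e y) = (\<Sum>i=1..m. B (frame_map e x) (e i) * B (frame_map e y) (e i))"
    by (rule onb_parseval[OF assms])
  also have "\<dots> = (\<Sum>i=1..m. B x (\<xi> i) * B y (\<xi> i))"
    by (rule sum.cong) (simp_all only: *)
  finally show "B (frame_map e x) (frame_map e y) = B x y"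
    by (simp only: onb_parseval[OF basis, of x y])
  have "map (frame_map e) (map \<xi> [1..<Suc m]) = map e [1..<Suc m]"
    by (auto simp: \<xi>)
  then show "ext_map (frame_map e) L = ext_mon (map e [1..<Suc m])"
    by (simp only: L_def ext_map_mon[OF lin])
qed

lemma SO_onb: "\<phi> \<in> SO \<Longrightarrow> onb (\<lambda>i. \<phi> (\<xi> i))"
  by (rule onbI) (simp only: SO_D(2) onb_B[OF basis])

text \<open>The inverse of an isometry is its adjoint, whose value at \<open>y\<close> has the
  coordinates \<open>B y (\<phi> (\<xi> i))\<close>.\<close>

lemma SO_inverse:
  assumes "\<phi> \<in> SO"
  obtains \<psi> where "\<psi> \<in> SO" "\<And>x. \<psi> (\<phi> x) = x" "\<And>x. \<phi> (\<psi> x) = x"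
proof -
  note \<phi> = SO_D[OF assms]
  define \<psi> where "\<psi> y = (\<Sum>i=1..m. B y (\<phi> (\<xi> i)) *\<^sub>R \<xi> i)" for y
  have 1: "\<psi> (\<phi> x) = x" for x
    using onb_expand[OF basis, of x] by (simp add: \<psi>_def \<phi>)
  have 2: "\<phi> (\<psi> y) = y" for y
    using onb_expand[OF SO_onb[OF assms], of y]
    by (simp add: \<psi>_def linear_sum[OF \<phi>(1)] linear_scale[OF \<phi>(1)])
  have lin: "linear \<psi>"
    unfolding \<psi>_def
    by (auto intro!: linearI simp: B_add B_scale scaleR_add_left sum.distrib scaleR_sum_right)
  have "B (\<psi> x) (\<psi> y) = B x y" for x y
    using \<phi>(2)[of "\<psi> x" "\<psi> y"] by (simp add: 2)
  moreover have "ext_map \<psi> L = L"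
    using ext_map_comp[OF \<phi>(1) lin, of L] by (simp add: \<phi>(3) 1 ext_map_id)
  ultimately have "\<psi> \<in> SO" using lin by (simp add: SO_iff)
  then show ?thesis using that 1 2 by blast
qed

text \<open>The star is made of contractions, which all isometries respect, and of \<open>L\<close>,
  which only those preserving orientation fix.\<close>

lemma star_ext_map:
  assumes "\<phi> \<in> SO"
  shows "ext_map \<phi> (star w) = star (ext_map \<phi> w)"
proof (rule ext_linear_eqI[of "\<lambda>w. ext_map \<phi> (star w)" "\<lambda>w. star (ext_map \<phi> w)"])
  note \<phi> = SO_D[OF assms] and l = linear_ext_map[OF SO_D(1)[OF assms]]
  show "ext_map \<phi> (star (ext_mon xs)) = star (ext_map \<phi> (ext_mon xs))" for xs
    unfolding star_mon ext_map_mon[OF \<phi>(1)] ext_map_Ds[OF \<phi>(1,2)] by (simp add: \<phi>(3))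
  show "linear (\<lambda>w. ext_map \<phi> (star w))" "linear (\<lambda>w. star (ext_map \<phi> w))"
    using linear_compose[OF linear_star l] linear_compose[OF l linear_star] by (simp_all add: o_def)
qed

section \<open>Structures of arity \<open>m - 3\<close> and bivectors\<close>

abbreviation bivector_structure :: "'v ext \<Rightarrow> 'v list \<Rightarrow> 'v" where
  "bivector_structure v \<equiv> derived_structure B (m - 3) (star v)"

abbreviation struct_iso :: "(('v list \<Rightarrow> 'v) \<times> ('v list \<Rightarrow> 'v)) set" where
  "struct_iso \<equiv> structure_iso B \<xi> m (m - 3)"

context
  assumes m: "3 \<le> m"
begin

text \<open>The potential of a structure of arity \<open>m - 3\<close> has degree
  \<open>m - 2\<close>, complementary to 2; for \<open>3 \<le> m\<close> the truncated subtraction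
  is a true one.\<close>

lemma star_bivector: "v \<in> ext_pow 2 \<Longrightarrow> star v \<in> ext_pow (Suc (m - 3))"
  using star_in_pow[of v 2] m by (simp add: Suc_diff_le[symmetric] numeral_eq_Suc)

lemma bivector_structure_invariant:
  "v \<in> ext_pow 2 \<Longrightarrow> bivector_structure v \<in> invariant_structures B (m - 3)"
  by (intro derived_structure_invariant star_bivector)

lemma bivector_structure_surj:
  assumes "f \<in> invariant_structures B (m - 3)"
  obtains v where "v \<in> ext_pow 2" "f = bivector_structure v"
proof -
  obtain \<mu> where \<mu>: "\<mu> \<in> ext_pow (Suc (m - 3))" "f = derived_structure B (m - 3) \<mu>"
    using derived_structure_surj[OF assms] by blast
  have "star (\<sigma> *\<^sub>R star \<mu>) = \<mu>"
    by (simp add: linear_scale[OF linear_star] star_star \<sigma>_sq)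
  moreover have "\<sigma> *\<^sub>R star \<mu> \<in> ext_pow 2"
    using star_in_pow[OF \<mu>(1)] m by (intro subspace_scale ext_pow_subspace) simp
  ultimately show ?thesis using that \<mu>(2) by metis
qed

lemma iso_bivector_structure:
  assumes "\<phi> \<in> SO" "v \<in> ext_pow 2"
  shows "(bivector_structure v, bivector_structure (ext_map \<phi> v)) \<in> struct_iso"
  unfolding structure_iso_def
  using bivector_structure_invariant[OF assms(2)]
    bivector_structure_invariant[OF ext_map_in_pow[OF SO_D(1)[OF assms(1)] assms(2)]]
    derived_structure_map[OF star_bivector[OF assms(2)] SO_D(1,2)[OF assms(1)]]
  by (auto simp: star_ext_map[OF assms(1)] intro!: bexI[OF _ assms(1)])

text \<open>The potentials of \<open>w\<close> and of the image of \<open>v\<close> have the same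
  derived structure on all lists \<open>map \<phi> vs\<close>. As \<open>\<phi>\<close> is onto,
  these are all lists, and a potential is determined by its structure.\<close>

lemma iso_bivector_structureD:
  assumes v: "v \<in> ext_pow 2" and w: "w \<in> ext_pow 2"
    and iso: "(bivector_structure v, bivector_structure w) \<in> struct_iso"
  obtains \<phi> where "\<phi> \<in> SO" "w = ext_map \<phi> v"
proof -
  obtain \<phi> where \<phi>: "\<phi> \<in> SO"
    and hom: "\<And>vs. length vs = m - 3 \<Longrightarrow> \<phi> (bivector_structure v vs) = bivector_structure w (map \<phi> vs)"
    using iso by (auto simp: structure_iso_def)
  obtain \<psi> where \<psi>: "\<And>x. \<phi> (\<psi> x) = x" using SO_inverse[OF \<phi>] by blast
  have v': "ext_map \<phi> v \<in> ext_pow 2" using ext_map_in_pow[OF SO_D(1)[OF \<phi>] v] .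
  have "star w = star (ext_map \<phi> v)"
  proof (rule derived_structure_inj[OF star_bivector[OF w] star_bivector[OF v']])
    fix as :: "'v list" assume as: "length as = m - 3"
    then have "bivector_structure (ext_map \<phi> v) (map \<phi> (map \<psi> as)) = bivector_structure w (map \<phi> (map \<psi> as))"
      using derived_structure_map[OF star_bivector[OF v] SO_D(1,2)[OF \<phi>], of "map \<psi> as"]
        hom[of "map \<psi> as"] by (simp add: star_ext_map[OF \<phi>])
    then show "bivector_structure w as = bivector_structure (ext_map \<phi> v) as"
      by (simp add: o_def \<psi>)
  qed
  then show ?thesis using \<phi> that by (simp add: star_inj)
qed

text \<open>On bivectors the relation is that of lying in one orbit of \<open>SO\<close>, so
  symmetry and transitivity come from inverses and composites in the group.\<close>

lemma equiv_iso: "equiv (invariant_structures B (m - 3)) struct_iso"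
proof (rule equivI)
  show sub: "struct_iso \<subseteq> invariant_structures B (m - 3) \<times> invariant_structures B (m - 3)"
    by (auto simp: structure_iso_def)
  show "refl_on (invariant_structures B (m - 3)) struct_iso"
  proof (rule refl_onI)
    fix f assume "f \<in> invariant_structures B (m - 3)"
    then show "(f, f) \<in> struct_iso"
      using SO_id by (auto simp: structure_iso_def intro!: bexI[of _ "\<lambda>x. x"])
  qed
  show "sym struct_iso"
  proof (rule symI)
    fix f g assume fg: "(f, g) \<in> struct_iso"
    obtain v where v: "v \<in> ext_pow 2" "f = bivector_structure v" using bivector_structure_surj fg sub by blast
    obtain w where w: "w \<in> ext_pow 2" "g = bivector_structure w" using bivector_structure_surj fg sub by blast
    obtain \<phi> where \<phi>: "\<phi> \<in> SO" "w = ext_map \<phi> v" using iso_bivector_structureD v w fg by blast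
    obtain \<psi> where \<psi>: "\<psi> \<in> SO" "\<And>x. \<psi> (\<phi> x) = x" using SO_inverse[OF \<phi>(1)] by blast
    have "ext_map \<psi> w = v"
      using ext_map_comp[OF SO_D(1)[OF \<phi>(1)] SO_D(1)[OF \<psi>(1)], of v] by (simp add: \<phi>(2) \<psi>(2) ext_map_id)
    then show "(g, f) \<in> struct_iso" using iso_bivector_structure[OF \<psi>(1) w(1)] v w by simp
  qed
  show "trans struct_iso"
  proof (rule transI)
    fix f g h assume fg: "(f, g) \<in> struct_iso" and gh: "(g, h) \<in> struct_iso"
    obtain u where u: "u \<in> ext_pow 2" "f = bivector_structure u" using bivector_structure_surj fg sub by blast
    obtain v where v: "v \<in> ext_pow 2" "g = bivector_structure v" using bivector_structure_surj fg sub by blast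
    obtain w where w: "w \<in> ext_pow 2" "h = bivector_structure w" using bivector_structure_surj gh sub by blast
    obtain \<phi> where \<phi>: "\<phi> \<in> SO" "v = ext_map \<phi> u" using iso_bivector_structureD u v fg by blast
    obtain \<psi> where \<psi>: "\<psi> \<in> SO" "w = ext_map \<psi> v" using iso_bivector_structureD v w gh by blast
    have "w = ext_map (\<lambda>x. \<psi> (\<phi> x)) u"
      using ext_map_comp[OF SO_D(1)[OF \<phi>(1)] SO_D(1)[OF \<psi>(1)], of u] by (simp add: \<phi>(2) \<psi>(2))
    then show "(f, h) \<in> struct_iso" using iso_bivector_structure[OF SO_comp[OF \<phi>(1) \<psi>(1)] u(1)] u w by simp
  qed
qed

end

end

section \<open>Skew operators\<close>

lemma sum_pairs:
  fixes g :: "nat \<Rightarrow> 'a::comm_monoid_add"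
  shows "(\<Sum>i=1..2*k. g i) = (\<Sum>j=1..k. g (2*j-1) + g (2*j))"
proof (induction k)
  case (Suc k)
  have "{1..2 * Suc k} = insert (2 * Suc k) (insert (2 * Suc k - 1) {1..2 * k})" by auto
  then show ?case by (simp add: Suc add_ac)
qed simp

lemma pair_index_cases:
  fixes i k :: nat
  assumes "i \<in> {1..2 * k}"
  obtains j where "j \<in> {1..k}" "i = 2 * j - 1" | j where "j \<in> {1..k}" "i = 2 * j"
proof (cases "even i")
  case True
  then obtain j where "i = 2 * j" by (elim evenE)
  then show ?thesis using assms that(2)[of j] by auto
next
  case False
  then obtain j where "i = 2 * j + 1" by (elim oddE)
  then show ?thesis using assms that(1)[of "Suc j"] by auto
qed

text \<open>A first-order condition without derivatives: \<open>t = a / K\<close> with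
  \<open>K\<close> beyond \<open>\<bar>c\<bar>\<close> is small enough for the linear term to
  win.\<close>

lemma linear_le_quadratic_imp_0:
  fixes a c :: real
  assumes "\<And>t. t * a \<le> t\<^sup>2 * c"
  shows "a = 0"
proof (rule ccontr)
  assume a: "a \<noteq> 0"
  define K where "K = \<bar>c\<bar> + 1"
  have K: "K > 0" "c < K" by (auto simp: K_def)
  have "a / K * a \<le> (a / K)\<^sup>2 * c" by (rule assms)
  then have "a\<^sup>2 * K \<le> a\<^sup>2 * c" using K by (simp add: field_simps power2_eq_square)
  then show False using a K by (simp add: mult_le_cancel_left)
qed

context orthonormal
begin

text \<open>The space carries no topology, so compactness is imported through coordinates, taken as
  functions on \<open>nat\<close> in the product topology. The bound is scaled by
  \<open>B x x\<close> so that it holds for all vectors of the complement, not only unit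
  vectors.\<close>

lemma sphere_max:
  assumes A: "linear A"
    and ex: "\<exists>x. x \<noteq> 0 \<and> (\<forall>j\<in>{1..r::nat}. B x (e j) = 0)"
  obtains u where "\<forall>j\<in>{1..r}. B u (e j) = 0" "B u u = 1"
    "\<And>x. \<forall>j\<in>{1..r}. B x (e j) = 0 \<Longrightarrow> B (A x) (A x) \<le> B (A u) (A u) * B x x"
proof -
  define X where "X c = (\<Sum>i=1..m. c i *\<^sub>R \<xi> i)" for c
  define co where "co x i = (if i \<in> {1..m} then B x (\<xi> i) else 0)" for x i
  have X_co: "X (co x) = x" for x
    using onb_expand[OF basis, of x] by (simp add: X_def co_def)
  \<comment> \<open>Coordinates outside \<open>{1..m}\<close> are pinned to 0, so that every factor
    of the infinite product is compact.\<close>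
  define K :: "(nat \<Rightarrow> real) set" where "K = PiE UNIV (\<lambda>i. if i \<in> {1..m} then {-1..1} else {0})"
  have "compactin (product_topology (\<lambda>_. euclidean) UNIV) K"
    unfolding K_def compactin_PiE by simp
  then have K: "compact K" by (simp add: euclidean_product_topology)
  define C where "C = K \<inter> {c. (\<Sum>i=1..m. (c i)\<^sup>2) = 1} \<inter> (\<Inter>j\<in>{1..r}. {c. B (X c) (e j) = 0})"
  have cont: "continuous_on UNIV (\<lambda>c :: nat \<Rightarrow> real. c i)" for i
    by simp
  have "closed {c :: nat \<Rightarrow> real. (\<Sum>i=1..m. (c i)\<^sup>2) = 1}"
    by (intro closed_Collect_eq continuous_intros cont)
  moreover have "closed {c. B (X c) (e j) = 0}" for j
    unfolding X_def B_sum B_scale by (intro closed_Collect_eq continuous_intros cont)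
  ultimately have C: "compact C"
    unfolding C_def by (intro compact_Int_closed K closed_INT ballI)
  have co_C: "co x \<in> C" if "\<forall>j\<in>{1..r}. B x (e j) = 0" "B x x = 1" for x
  proof -
    have sq: "(\<Sum>i=1..m. (co x i)\<^sup>2) = 1"
      using onb_parseval[OF basis, of x x] that(2) by (simp add: co_def power2_eq_square)
    have "\<bar>co x i\<bar> \<le> 1" if "i \<in> {1..m}" for i
    proof -
      have "(co x i)\<^sup>2 \<le> (\<Sum>i=1..m. (co x i)\<^sup>2)"
        using that by (intro member_le_sum) auto
      then show ?thesis using sq by (simp add: abs_square_le_1)
    qed
    then have "co x \<in> K" by (auto simp: K_def co_def abs_le_iff)
    then show ?thesis using sq that(1) by (simp add: C_def X_co)
  qed
  have normalize: "\<exists>s. s > 0 \<and> s\<^sup>2 * B x x = 1" if "x \<noteq> 0" for x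
    using B_gt_0[OF that] by (intro exI[of _ "1 / sqrt (B x x)"]) (simp add: power_divide)
  obtain x s where x: "\<forall>j\<in>{1..r}. B x (e j) = 0" and "s > 0" "s\<^sup>2 * B x x = 1"
    using ex normalize by blast
  then have "co (s *\<^sub>R x) \<in> C" by (intro co_C) (simp_all add: B_scale power2_eq_square mult.assoc)
  then have "C \<noteq> {}" by blast
  have "B (A (X c)) (A (X c)) = (\<Sum>i=1..m. c i * (\<Sum>j=1..m. c j * B (A (\<xi> j)) (A (\<xi> i))))" for c
    unfolding X_def by (simp add: linear_sum[OF A] linear_scale[OF A] B_sum B_scale)
  then have "continuous_on UNIV (\<lambda>c. B (A (X c)) (A (X c)))"
    by (simp only:) (intro continuous_intros cont)
  then have "continuous_on C (\<lambda>c. B (A (X c)) (A (X c)))"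
    by (rule continuous_on_subset) simp
  from continuous_attains_sup[OF C \<open>C \<noteq> {}\<close> this] obtain c where c: "c \<in> C"
    and max: "\<And>d. d \<in> C \<Longrightarrow> B (A (X d)) (A (X d)) \<le> B (A (X c)) (A (X c))" by blast
  show ?thesis
  proof (rule that)
    show "\<forall>j\<in>{1..r}. B (X c) (e j) = 0" using c by (simp add: C_def)
    have "B (X c) (X c) = (\<Sum>i=1..m. c i * (\<Sum>j=1..m. c j * B (\<xi> j) (\<xi> i)))"
      unfolding X_def by (simp add: B_sum B_scale)
    also have "\<dots> = (\<Sum>i=1..m. c i * (\<Sum>j=1..m. if j = i then c j else 0))"
      by (intro sum.cong refl arg_cong2[of _ _ _ _ "(*)"]) (simp add: onb_B[OF basis])
    also have "\<dots> = 1" using c by (simp add: C_def power2_eq_square)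
    finally show "B (X c) (X c) = 1" .
    fix x assume x: "\<forall>j\<in>{1..r}. B x (e j) = 0"
    show "B (A x) (A x) \<le> B (A (X c)) (A (X c)) * B x x"
    proof (cases "x = 0")
      case True
      then show ?thesis by (simp add: linear_0[OF A] B_0)
    next
      case False
      then obtain s where s: "s > 0" "s\<^sup>2 * B x x = 1" using normalize by blast
      then have "co (s *\<^sub>R x) \<in> C" using x by (intro co_C) (simp_all add: B_scale power2_eq_square mult.assoc)
      from max[OF this] have "s\<^sup>2 * B (A x) (A x) \<le> B (A (X c)) (A (X c))"
        by (simp add: X_co linear_scale[OF A] B_scale power2_eq_square mult.assoc)
      also have "\<dots> = s\<^sup>2 * (B (A (X c)) (A (X c)) * B x x)" using s(2) by (simp add: mult.left_commute)
      finally show ?thesis using s(1) by (simp add: mult_le_cancel_left)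
    qed
  qed
qed

text \<open>Along \<open>u + t *\<^sub>R y\<close> the inequality \<open>max\<close> is an equality
  at \<open>t = 0\<close>, so the term linear in \<open>t\<close> must vanish.\<close>

lemma sphere_max_stationary:
  assumes A: "linear A" and u: "\<forall>j\<in>{1..r::nat}. B u (e j) = 0" "B u u = 1"
    and max: "\<And>x. \<forall>j\<in>{1..r}. B x (e j) = 0 \<Longrightarrow> B (A x) (A x) \<le> M * B x x"
    and M: "M = B (A u) (A u)"
    and y: "\<forall>j\<in>{1..r}. B y (e j) = 0"
  shows "B (A u) (A y) = M * B u y"
proof -
  have "2 * (B (A u) (A y) - M * B u y) = 0"
  proof (rule linear_le_quadratic_imp_0)
    fix t
    have "B (A (u + t *\<^sub>R y)) (A (u + t *\<^sub>R y)) \<le> M * B (u + t *\<^sub>R y) (u + t *\<^sub>R y)"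
      using u y by (intro max) (simp add: B_add B_scale)
    then show "t * (2 * (B (A u) (A y) - M * B u y)) \<le> t\<^sup>2 * (M * B y y - B (A y) (A y))"
      by (simp add: linear_add[OF A] linear_scale[OF A] B_add B_scale sym[of y u] sym[of "A y" "A u"]
          u(2) M[symmetric] algebra_simps power2_eq_square)
  qed
  then show ?thesis by simp
qed

lemma exists_orthogonal_basis:
  assumes "r < m"
  shows "\<exists>x. x \<noteq> 0 \<and> (\<forall>j\<in>{1..r}. B x (f j) = 0)"
proof -
  have "r < card (\<xi> ` {1..m})" "r \<le> m" using assms finite_basis(3) by simp_all
  from exists_orthogonal[OF finite_basis(1) this, of f] show ?thesis by metis
qed

section \<open>Splitting off invariant planes of a skew operator\<close>

definition orthonormal_on :: "nat set \<Rightarrow> (nat \<Rightarrow> 'v) \<Rightarrow> bool" where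
  "orthonormal_on I e \<longleftrightarrow> (\<forall>i\<in>I. \<forall>j\<in>I. B (e i) (e j) = (if i = j then 1 else 0))"

lemma orthonormal_on_onb: "onb e \<longleftrightarrow> orthonormal_on {1..m} e"
  using onbI onb_B unfolding orthonormal_on_def by metis

lemma orthonormal_on_update:
  assumes e: "orthonormal_on I e" and n: "n \<notin> I" and u: "\<forall>i\<in>I. B u (e i) = 0" "B u u = 1"
  shows "orthonormal_on (insert n I) (e(n := u))"
proof -
  have "\<forall>i\<in>I. B (e i) u = 0" using u(1) sym by metis
  moreover have "\<And>i. i \<in> I \<Longrightarrow> i \<noteq> n" using n by blast
  ultimately show ?thesis using e u by (auto simp: orthonormal_on_def)
qed

definition skew :: "('v \<Rightarrow> 'v) \<Rightarrow> bool" where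
  "skew A \<longleftrightarrow> linear A \<and> (\<forall>x y. B (A x) y = - B x (A y))"

definition block_frame :: "('v \<Rightarrow> 'v) \<Rightarrow> nat \<Rightarrow> (nat \<Rightarrow> 'v) \<Rightarrow> (nat \<Rightarrow> real) \<Rightarrow> bool" where
  "block_frame A k e a \<longleftrightarrow>
     orthonormal_on {1..2*k} e \<and>
     (\<forall>j\<in>{1..k}. A (e (2*j-1)) = a j *\<^sub>R e (2*j) \<and> A (e (2*j)) = - a j *\<^sub>R e (2*j-1) \<and> 0 \<le> a j)"

text \<open>The span of the frame is stable under \<open>A\<close>, and a skew operator then
  preserves its orthogonal complement.\<close>

lemma block_frame_perp:
  assumes "skew A" "block_frame A k e a" "\<forall>i\<in>{1..2*k}. B x (e i) = 0"
  shows "\<forall>i\<in>{1..2*k}. B (A x) (e i) = 0"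
proof
  fix i assume "i \<in> {1..2*k}"
  then have "B x (A (e i)) = 0"
  proof (cases rule: pair_index_cases)
    case (1 j)
    then show ?thesis using assms(2,3) by (auto simp: block_frame_def B_scale)
  next
    case (2 j)
    then have "2 * j - 1 \<in> {1..2*k}" by auto
    then show ?thesis using 2 assms(2,3) by (auto simp: block_frame_def B_scale B_minus)
  qed
  then show "B (A x) (e i) = 0" using assms(1) by (simp add: skew_def)
qed

text \<open>A maximiser \<open>u\<close> satisfies
  \<open>A (A u) = - (s\<^sup>2 *\<^sub>R u)\<close>, where \<open>s\<close> is the norm of
  \<open>A u\<close>; so for nonzero \<open>s\<close> the vectors \<open>u\<close> and
  \<open>A u\<close> span an invariant plane. The bound is handed on for ordering the
  coefficients.\<close>

lemma block_frame_extend: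
  assumes A: "skew A" and f: "block_frame A k e a" and m: "2 * Suc k \<le> m"
  obtains u w s where "block_frame A (Suc k) (e(2*k+1 := u, 2*k+2 := w)) (a(Suc k := s))"
    "\<forall>i\<in>{1..2*k}. B u (e i) = 0" "B u u = 1" "B (A u) (A u) = s\<^sup>2"
    "\<And>x. \<forall>i\<in>{1..2*k}. B x (e i) = 0 \<Longrightarrow> B (A x) (A x) \<le> s\<^sup>2 * B x x"
proof -
  have lin: "linear A" and sk: "\<And>x y. B (A x) y = - B x (A y)" using A by (simp_all add: skew_def)
  have ex: "\<exists>x. x \<noteq> 0 \<and> (\<forall>j\<in>{1..2*k}. B x (e j) = 0)"
    using exists_orthogonal_basis m by simp
  obtain u where u: "\<forall>j\<in>{1..2*k}. B u (e j) = 0" "B u u = 1"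
    and max: "\<And>x. \<forall>j\<in>{1..2*k}. B x (e j) = 0 \<Longrightarrow> B (A x) (A x) \<le> B (A u) (A u) * B x x"
    by (rule sphere_max[OF lin ex]) blast
  define s where "s = sqrt (B (A u) (A u))"
  have s: "B (A u) (A u) = s\<^sup>2" "0 \<le> s" using B_pos by (simp_all add: s_def)
  note perp = block_frame_perp[OF A f]
  have uAu: "B u (A u) = 0" using sk[of u u] sym[of u "A u"] by linarith
  \<comment> \<open>The vector \<open>y\<close> is itself an admissible direction of variation.
    Stationarity in this direction, moved across by skewness, reads
    \<open>B y y = 0\<close>.\<close>
  have "A (A u) + s\<^sup>2 *\<^sub>R u = 0"
  proof -
    define y where "y = A (A u) + s\<^sup>2 *\<^sub>R u"
    have y: "\<forall>j\<in>{1..2*k}. B y (e j) = 0"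
      using perp[OF perp[OF u(1)]] u(1) by (simp add: y_def B_add B_scale)
    have "B (A u) (A y) = s\<^sup>2 * B u y"
      using sphere_max_stationary[OF lin u max[unfolded s] s(1)[symmetric] y] .
    then have "B (A (A u)) y + s\<^sup>2 * B u y = 0" using sk[of "A u" y] by linarith
    then have "B y y = 0" by (simp add: y_def B_add B_scale sym[of u "A (A u)"])
    then show ?thesis by (simp add: B_eq_0 y_def)
  qed
  then have AAu: "A (A u) = - (s\<^sup>2 *\<^sub>R u)" by (simp add: add_eq_0_iff2)
  \<comment> \<open>For \<open>s = 0\<close> maximality makes \<open>A\<close> vanish on the whole
    complement, so any unit vector orthogonal to \<open>u\<close> and the frame is a partner;
    \<open>2 * Suc k \<le> m\<close> leaves room for it. Otherwise the partner is the normalized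
    \<open>A u\<close>.\<close>
  have "\<exists>w. (\<forall>j\<in>{1..2*k}. B w (e j) = 0) \<and> B w u = 0 \<and> B w w = 1 \<and> A u = s *\<^sub>R w \<and> A w = - s *\<^sub>R u"
  proof (cases "s = 0")
    case True
    obtain x where x: "x \<noteq> 0" "\<And>j. j \<in> {1..2*k+1} \<Longrightarrow> B x ((e(2*k+1 := u)) j) = 0"
      using exists_orthogonal_basis[of "2*k+1" "e(2*k+1 := u)"] m by auto
    define w where "w = (1 / sqrt (B x x)) *\<^sub>R x"
    have "B w w = 1" using B_gt_0[OF x(1)] by (simp add: w_def B_scale)
    moreover have "B w u = 0" using x(2)[of "2*k+1"] by (simp add: w_def B_scale)
    moreover have w: "\<forall>j\<in>{1..2*k}. B w (e j) = 0"
    proof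
      fix j assume "j \<in> {1..2*k}"
      then show "B w (e j) = 0" using x(2)[of j] by (simp add: w_def B_scale)
    qed
    moreover have "A y = 0" if "\<forall>j\<in>{1..2*k}. B y (e j) = 0" for y
      using max[OF that] B_pos[of "A y"] True by (simp add: s B_eq_0[symmetric])
    ultimately show ?thesis using u w True by (intro exI[of _ w]) simp
  next
    case False
    define w where "w = (1 / s) *\<^sub>R A u"
    have "\<forall>j\<in>{1..2*k}. B w (e j) = 0" using perp[OF u(1)] by (simp add: w_def B_scale)
    moreover have "B w u = 0" using uAu sym[of u "A u"] by (simp add: w_def B_scale)
    moreover have "B w w = 1" using False s by (simp add: w_def B_scale power2_eq_square)
    moreover have "A u = s *\<^sub>R w" using False by (simp add: w_def)
    moreover have "A w = - s *\<^sub>R u"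
      using False by (simp add: w_def linear_scale[OF lin] AAu power2_eq_square)
    ultimately show ?thesis by blast
  qed
  then obtain w where w: "\<forall>j\<in>{1..2*k}. B w (e j) = 0" "B w u = 0" "B w w = 1"
    and Au: "A u = s *\<^sub>R w" and Aw: "A w = - s *\<^sub>R u" by blast
  let ?e = "e(2*k+1 := u, 2*k+2 := w)" and ?a = "a(Suc k := s)"
  have e: "orthonormal_on {1..2*k} e" using f by (simp add: block_frame_def)
  have I: "{1..2 * Suc k} = insert (2*k+2) (insert (2*k+1) {1..2*k})" by auto
  have J: "{1..Suc k} = insert (Suc k) {1..k}" by auto
  have "block_frame A (Suc k) ?e ?a"
    unfolding block_frame_def
  proof (intro conjI)
    have "orthonormal_on (insert (2*k+1) {1..2*k}) (e(2*k+1 := u))"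
      using u by (intro orthonormal_on_update e) auto
    then show "orthonormal_on {1..2 * Suc k} ?e"
      unfolding I by (rule orthonormal_on_update) (use w in auto)
    have "A (?e (2*j-1)) = ?a j *\<^sub>R ?e (2*j) \<and> A (?e (2*j)) = - ?a j *\<^sub>R ?e (2*j-1) \<and> 0 \<le> ?a j"
      if "j \<in> {1..k}" for j
    proof -
      have "2*j-1 \<noteq> 2*k+1" "2*j-1 \<noteq> 2*k+2" "2*j \<noteq> 2*k+1" "2*j \<noteq> 2*k+2" "j \<noteq> Suc k"
        using that by auto
      then show ?thesis using f that by (simp add: block_frame_def)
    qed
    moreover have "2 * Suc k - 1 = 2*k+1" "2 * Suc k = 2*k+2" by auto
    ultimately show "\<forall>j\<in>{1..Suc k}. A (?e (2*j-1)) = ?a j *\<^sub>R ?e (2*j) \<and>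
        A (?e (2*j)) = - ?a j *\<^sub>R ?e (2*j-1) \<and> 0 \<le> ?a j"
      unfolding J using Au Aw s(2) by simp
  qed
  then show ?thesis using that u s max by simp
qed

text \<open>The norm bound is carried along because the next maximiser lies in the complement that
  the bound speaks of, whence the coefficients decrease. For \<open>k = 0\<close> there is no
  coefficient to compare with, hence the guard.\<close>

lemma block_frame_exists:
  assumes A: "skew A" and "2 * k \<le> m"
  shows "\<exists>e a. block_frame A k e a \<and> (\<forall>j\<in>{1..<k}. a (Suc j) \<le> a j) \<and>
    (1 \<le> k \<longrightarrow> (\<forall>x. (\<forall>i\<in>{1..2*k}. B x (e i) = 0) \<longrightarrow> B (A x) (A x) \<le> (a k)\<^sup>2 * B x x))"
  using assms(2)
proof (induction k)
  case 0
  show ?case by (simp add: block_frame_def orthonormal_on_def)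
next
  case (Suc k)
  then obtain e a where f: "block_frame A k e a" and mono: "\<forall>j\<in>{1..<k}. a (Suc j) \<le> a j"
    and bound: "1 \<le> k \<Longrightarrow> \<forall>i\<in>{1..2*k}. B x (e i) = 0 \<Longrightarrow> B (A x) (A x) \<le> (a k)\<^sup>2 * B x x" for x
    by auto
  obtain u w s where f': "block_frame A (Suc k) (e(2*k+1 := u, 2*k+2 := w)) (a(Suc k := s))"
    and u: "\<forall>i\<in>{1..2*k}. B u (e i) = 0" "B u u = 1" "B (A u) (A u) = s\<^sup>2"
    and max: "\<And>x. \<forall>i\<in>{1..2*k}. B x (e i) = 0 \<Longrightarrow> B (A x) (A x) \<le> s\<^sup>2 * B x x"
    by (rule block_frame_extend[OF A f Suc.prems]) blast
  let ?e = "e(2*k+1 := u, 2*k+2 := w)" and ?a = "a(Suc k := s)"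
  have "?a (Suc j) \<le> ?a j" if "j \<in> {1..<Suc k}" for j
  proof (cases "j = k")
    case True
    then have "s\<^sup>2 \<le> (a k)\<^sup>2" "0 \<le> a k"
      using bound[OF _ u(1)] u that f by (auto simp: block_frame_def)
    then have "s \<le> a k" by (rule power2_le_imp_le)
    then show ?thesis using True by simp
  next
    case False
    then show ?thesis using mono that by auto
  qed
  moreover have "B (A x) (A x) \<le> (?a (Suc k))\<^sup>2 * B x x" if "\<forall>i\<in>{1..2 * Suc k}. B x (?e i) = 0" for x
  proof -
    have "B x (e i) = 0" if "i \<in> {1..2*k}" for i
      using \<open>\<forall>i\<in>{1..2 * Suc k}. B x (?e i) = 0\<close>[THEN bspec, of i] that by auto
    then show ?thesis using max[of x] by simp
  qed
  ultimately show ?case using f' by blast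
qed

lemma skew_normal_form:
  assumes A: "skew A"
  obtains e a where "onb e" "block_frame A (m div 2) e a"
    "\<forall>j\<in>{1..<m div 2}. a (Suc j) \<le> a j" "odd m \<Longrightarrow> A (e m) = 0"
proof -
  let ?k = "m div 2"
  obtain e a where f: "block_frame A ?k e a" and mono: "\<forall>j\<in>{1..<?k}. a (Suc j) \<le> a j"
    using block_frame_exists[OF A, of ?k] by auto
  have e: "orthonormal_on {1..2*?k} e" using f by (simp add: block_frame_def)
  show ?thesis
  proof (cases "even m")
    case True
    then have "onb e" using e by (simp add: orthonormal_on_onb)
    then show ?thesis using that f mono True by blast
  next
    case False
    then have m: "m = 2 * ?k + 1" by presburger
    obtain x where x: "x \<noteq> 0" "\<And>j. j \<in> {1..2*?k} \<Longrightarrow> B x (e j) = 0"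
      using exists_orthogonal_basis[of "2*?k" e] m by auto
    define u where "u = (1 / sqrt (B x x)) *\<^sub>R x"
    have u: "B u u = 1" "\<And>j. j \<in> {1..2*?k} \<Longrightarrow> B u (e j) = 0"
      using B_gt_0[OF x(1)] x(2) by (simp_all add: u_def B_scale)
    let ?e = "e(m := u)"
    have ne: "i \<noteq> m" if "i \<in> {1..2*?k}" for i using that m by auto
    have I: "{1..m} = insert m {1..2*?k}" using m by auto
    have onb: "onb ?e"
      unfolding orthonormal_on_onb I by (rule orthonormal_on_update[OF e]) (use u ne in auto)
    \<comment> \<open>For odd \<open>m\<close> one unit vector is left over. Its image is orthogonal
      to the frame, and to \<open>u\<close> by skewness.\<close>
    have "A u = 0"
    proof (rule onb_eq_0[OF onb])
      fix i assume "i \<in> {1..m}"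
      moreover have "B (A u) u = 0"
      proof -
        have "B (A u) u = - B u (A u)" using A by (simp only: skew_def)
        then show ?thesis using sym[of u "A u"] by linarith
      qed
      moreover have "\<forall>i\<in>{1..2*?k}. B (A u) (e i) = 0" by (rule block_frame_perp[OF A f]) (use u in auto)
      ultimately show "B (A u) (?e i) = 0" unfolding I using ne by auto
    qed
    moreover have "block_frame A ?k ?e a"
    proof -
      have "2 * j \<noteq> m" "2 * j - 1 \<noteq> m" if "j \<in> {1..?k}" for j using that m by auto
      moreover have "orthonormal_on {1..2*?k} ?e"
        using e ne unfolding orthonormal_on_def by simp
      ultimately show ?thesis using f unfolding block_frame_def by simp
    qed
    ultimately show ?thesis using that onb mono by simp
  qed
qed

end

section \<open>Normal forms of bivectors\<close>

text \<open>The binomial theorem, cut off after the term linear in \<open>x\<close>.\<close>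

lemma power_add_square_zero:
  fixes s x :: "'a::real_algebra_1"
  assumes "s * x = x * s" "x * x = 0"
  shows "(s + x) ^ Suc n = s ^ Suc n + real (Suc n) *\<^sub>R (s ^ n * x)"
proof (induction n)
  case (Suc n)
  have c: "s ^ k * x = x * s ^ k" for k
    by (induction k) (simp_all add: assms(1) mult.assoc, metis assms(1) mult.assoc)
  have "x * (s ^ n * x) = 0" by (metis c assms(2) mult.assoc mult_zero_right)
  then have "(s + x) * (s ^ Suc n + real (Suc n) *\<^sub>R (s ^ n * x))
      = s ^ Suc (Suc n) + x * s ^ Suc n + real (Suc n) *\<^sub>R (s ^ Suc n * x)"
    by (simp add: distrib_left distrib_right mult.assoc)
  also have "\<dots> = s ^ Suc (Suc n) + real (Suc (Suc n)) *\<^sub>R (s ^ Suc n * x)"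
    by (simp only: c[symmetric] of_nat_Suc[of "Suc n"] scaleR_add_left) simp
  finally show ?case by (metis Suc power_Suc)
qed simp

lemma ext_gen2_commute: "ext_gen x * ext_gen y * w = w * (ext_gen x * ext_gen y)"
proof (induction w rule: ext_induct)
  case (mon xs)
  show ?case using ext_mon_supercomm[of "[x, y]" xs] by (simp add: mult.assoc)
qed (simp_all add: distrib_left distrib_right)

lemma ext_gen2_sq: "ext_gen x * ext_gen y * (ext_gen x * ext_gen y) = 0"
proof -
  have "ext_gen x * ext_gen y * (ext_gen x * ext_gen y) = - (ext_gen y * (ext_gen x * ext_gen x) * ext_gen y)"
    by (subst (1) ext_gen_anticomm) (simp add: mult.assoc)
  then show ?thesis by (simp add: ext_gen_sq)
qed

definition block_bivector :: "nat \<Rightarrow> (nat \<Rightarrow> 'v::real_vector) \<Rightarrow> (nat \<Rightarrow> real) \<Rightarrow> 'v ext" where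
  "block_bivector k e a = (\<Sum>j=1..k. a j *\<^sub>R (ext_gen (e (2*j-1)) * ext_gen (e (2*j))))"

lemma ext_map_block_bivector:
  assumes "linear \<phi>"
  shows "ext_map \<phi> (block_bivector k e a) = block_bivector k (\<lambda>i. \<phi> (e i)) a"
  unfolding block_bivector_def
  by (simp add: linear_sum[OF linear_ext_map[OF assms]] linear_scale[OF linear_ext_map[OF assms]]
      ext_map_mult[OF assms] ext_map_gen[OF assms])

lemma block_bivector_cong:
  assumes "\<And>i. i \<in> {1..2*k} \<Longrightarrow> e i = e' i"
  shows "block_bivector k e a = block_bivector k e' a"
  unfolding block_bivector_def
proof (rule sum.cong[OF refl])
  fix j assume "j \<in> {1..k}"
  then have "2 * j - 1 \<in> {1..2*k}" "2 * j \<in> {1..2*k}" by auto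
  then show "a j *\<^sub>R (ext_gen (e (2*j-1)) * ext_gen (e (2*j)))
      = a j *\<^sub>R (ext_gen (e' (2*j-1)) * ext_gen (e' (2*j)))"
    by (simp only: assms)
qed

lemma block_bivector_in_pow: "block_bivector k e a \<in> ext_pow 2"
proof -
  have "ext_gen x * ext_gen y \<in> ext_pow 2" for x y :: 'a
    using ext_mon_in_pow[of "[x, y]"] by (simp add: numeral_2_eq_2)
  then show ?thesis
    unfolding block_bivector_def by (intro subspace_sum subspace_scale ext_pow_subspace)
qed

text \<open>The vanishing of the next power belongs to the induction: when a plane is added, it
  removes the pure power of the old part. The term linear in the new plane survives, and its factor
  \<open>Suc k\<close> builds the factorial.\<close>

lemma block_bivector_power:
  "block_bivector k e a ^ k = (fact k * (\<Prod>j=1..k. a j)) *\<^sub>R ext_mon (map e [1..<Suc (2*k)])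
   \<and> block_bivector k e a ^ Suc k = 0"
proof (induction k)
  case 0
  show ?case by (simp add: block_bivector_def)
next
  case (Suc k)
  let ?s = "block_bivector k e a" and ?y = "ext_gen (e (2*k+1)) * ext_gen (e (2*k+2))"
  let ?x = "a (Suc k) *\<^sub>R ?y"
  have "2 * Suc k - 1 = 2*k+1" "2 * Suc k = 2*k+2" by simp_all
  then have bb: "block_bivector (Suc k) e a = ?s + ?x"
    by (simp only: block_bivector_def sum.nat_ivl_Suc')
      (simp add: add.commute)
  have c: "?s * ?x = ?x * ?s" by (simp add: ext_gen2_commute)
  have x: "?x * ?x = 0" by (simp add: ext_gen2_sq)
  have L: "ext_mon (map e [1..<Suc (2 * Suc k)]) = ext_mon (map e [1..<Suc (2*k)]) * ?y"
    by (simp add: upt_Suc_append mult.assoc flip: Suc_eq_plus1)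
  have "block_bivector (Suc k) e a ^ Suc k = real (Suc k) *\<^sub>R (?s ^ k * ?x)"
    unfolding bb power_add_square_zero[OF c x] using Suc by (simp only: add_0_left)
  also have "\<dots> = (fact (Suc k) * (\<Prod>j=1..Suc k. a j)) *\<^sub>R ext_mon (map e [1..<Suc (2 * Suc k)])"
    unfolding L using Suc by (simp add: mult_ac)
  finally have 1: "block_bivector (Suc k) e a ^ Suc k
      = (fact (Suc k) * (\<Prod>j=1..Suc k. a j)) *\<^sub>R ext_mon (map e [1..<Suc (2 * Suc k)])" .
  have "?s ^ Suc k = 0" using Suc by blast
  then have "block_bivector (Suc k) e a ^ Suc (Suc k) = 0"
    unfolding bb power_add_square_zero[OF c x, of "Suc k"] by simp
  with 1 show ?case by blast
qed

lemma antimono_chain: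
  fixes a :: "nat \<Rightarrow> real"
  assumes "\<forall>j\<in>{1..<n}. a (Suc j) \<le> a j" "1 \<le> l" "l \<le> j" "j \<le> n"
  shows "a j \<le> a l"
  using assms(3,4)
proof (induction j rule: dec_induct)
  case (step j)
  then have "a (Suc j) \<le> a j" using assms(1,2) by auto
  then show ?case using step by auto
qed simp

text \<open>What both parities share for uniqueness: absolute values decrease, and only the last
  coefficient for even \<open>m\<close> may be negative. An even \<open>m\<close> with
  \<open>3 \<le> m\<close> has at least two planes, so the index \<open>m div 2 - 1\<close> is
  genuine.\<close>

lemma normal_coefficientsD:
  assumes m: "3 \<le> m" and a: "a \<in> normal_coefficients m"
  shows "\<And>j. 1 \<le> j \<Longrightarrow> j \<le> m div 2 \<Longrightarrow> odd m \<or> j < m div 2 \<Longrightarrow> 0 \<le> a j"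
    and "\<And>l j. 1 \<le> l \<Longrightarrow> l \<le> j \<Longrightarrow> j \<le> m div 2 \<Longrightarrow> \<bar>a j\<bar> \<le> \<bar>a l\<bar>"
proof -
  let ?k = "m div 2"
  have *: "(1 \<le> j \<longrightarrow> j \<le> ?k \<longrightarrow> odd m \<or> j < ?k \<longrightarrow> 0 \<le> a j) \<and>
    (1 \<le> l \<longrightarrow> l \<le> j \<longrightarrow> j \<le> ?k \<longrightarrow> \<bar>a j\<bar> \<le> \<bar>a l\<bar>)" for l j
  proof (cases "odd m")
    case True
    then have "0 \<le> a ?k" "\<forall>j\<in>{1..<?k}. a (Suc j) \<le> a j"
      using a by (simp_all add: normal_coefficients_def Let_def)
    then have pos: "0 \<le> a j" if "1 \<le> j" "j \<le> ?k" for j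
      using antimono_chain[of ?k a j ?k] that by simp
    show ?thesis
      using pos[of j] pos[of l] antimono_chain[of ?k a l j] \<open>\<forall>j\<in>{1..<?k}. a (Suc j) \<le> a j\<close> by auto
  next
    case False
    then have last: "\<bar>a ?k\<bar> \<le> a (?k - 1)" and mono: "\<forall>j\<in>{1..<?k - 1}. a (Suc j) \<le> a j"
      using a by (simp_all add: normal_coefficients_def Let_def)
    have k: "2 \<le> ?k" using False m by presburger
    have le: "a j \<le> a l" if "1 \<le> l" "l \<le> j" "j \<le> ?k - 1" for l j
      using antimono_chain[OF mono that] .
    have pos: "\<bar>a ?k\<bar> \<le> a j" if "1 \<le> j" "j < ?k" for j
    proof -
      have "j \<le> ?k - 1" using that by simp
      then show ?thesis using le[of j "?k - 1"] last that(1) by linarith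
    qed
    have "\<bar>a j\<bar> \<le> \<bar>a l\<bar>" if "1 \<le> l" "l \<le> j" "j \<le> ?k"
    proof (cases "j = ?k")
      case True
      then show ?thesis using pos[of l] that by (cases "l = ?k") auto
    next
      case False
      then have "j \<le> ?k - 1" "j < ?k" using that by auto
      then show ?thesis using le[of l j] pos[of j] that by linarith
    qed
    then show ?thesis using False pos[of j] by auto
  qed
  show "\<And>j. 1 \<le> j \<Longrightarrow> j \<le> m div 2 \<Longrightarrow> odd m \<or> j < m div 2 \<Longrightarrow> 0 \<le> a j"
    and "\<And>l j. 1 \<le> l \<Longrightarrow> l \<le> j \<Longrightarrow> j \<le> m div 2 \<Longrightarrow> \<bar>a j\<bar> \<le> \<bar>a l\<bar>"
    using * by blast+
qed

lemma normal_vectors_eq: "normal_vectors \<xi> m = block_bivector (m div 2) \<xi> ` normal_coefficients m"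
  by (simp add: normal_vectors_def block_bivector_def[abs_def])

section \<open>Existence of the normal form\<close>

context orthonormal
begin

text \<open>A contraction turns a bivector into a vector, and the anticommutation of two
  contractions is the skewness of this operator.\<close>

lemma bivector_operator:
  assumes v: "v \<in> ext_pow 2"
  obtains A where "skew A" "\<And>x. ext_gen (A x) = D x v"
proof -
  have "\<forall>x. \<exists>y. ext_gen y = D x v"
    using D_in_pow[of v 1] v ext_pow_1 by (metis Suc_1)
  then obtain A where A: "\<And>x. ext_gen (A x) = D x v" by metis
  have "linear A"
  proof (rule linearI)
    fix x y c
    have "ext_gen (A (x + y)) = ext_gen (A x + A y)" by (simp add: A ext_gen_add D_left_add)
    then show "A (x + y) = A x + A y" by (simp add: inj_ext_gen)
    have "ext_gen (A (c *\<^sub>R x)) = ext_gen (c *\<^sub>R A x)" by (simp add: A ext_gen_scaleR D_left_scale)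
    then show "A (c *\<^sub>R x) = c *\<^sub>R A x" by (simp add: inj_ext_gen)
  qed
  moreover have "B (A x) y = - B x (A y)" for x y
  proof -
    have "B y (A x) *\<^sub>R (1 :: 'v ext) = (- B x (A y)) *\<^sub>R 1"
      using D_anticomm[of y x v] by (simp add: A[symmetric] D_gen)
    then show ?thesis using sym[of y "A x"] by (simp only: scaleR_cancel_right) simp
  qed
  ultimately have "skew A" by (simp add: skew_def)
  then show ?thesis using that A by blast
qed

text \<open>Euler's identity in degree 2 rebuilds \<open>v\<close> from its operator in any
  orthonormal basis. Each plane appears twice, once for each of its vectors.\<close>

lemma bivector_eq_block_bivector:
  assumes v: "v \<in> ext_pow 2" and A: "skew A" "\<And>x. ext_gen (A x) = D x v"
    and e: "onb e" "block_frame A (m div 2) e a" "odd m \<Longrightarrow> A (e m) = 0"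
  shows "v = block_bivector (m div 2) e a"
proof -
  let ?k = "m div 2" and ?g = "\<lambda>i. ext_gen (e i) * ext_gen (A (e i))"
  have "2 *\<^sub>R v = (\<Sum>i=1..m. ?g i)"
    using ext_euler[OF e(1) v] by (simp add: A)
  also have "\<dots> = (\<Sum>i=1..2*?k. ?g i)"
  proof (cases "even m")
    case False
    then have "{1..m} = insert m {1..2*?k}" "m \<notin> {1..2*?k}" by (auto elim!: oddE)
    then show ?thesis using e(3) False by (simp add: linear_0[OF linear_ext_gen])
  qed simp
  also have "\<dots> = (\<Sum>j=1..?k. 2 *\<^sub>R a j *\<^sub>R (ext_gen (e (2*j-1)) * ext_gen (e (2*j))))"
    unfolding sum_pairs
  proof (rule sum.cong[OF refl])
    fix j assume "j \<in> {1..?k}"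
    then have "A (e (2*j-1)) = a j *\<^sub>R e (2*j)" "A (e (2*j)) = - a j *\<^sub>R e (2*j-1)"
      using e(2) by (simp_all add: block_frame_def)
    then show "?g (2*j-1) + ?g (2*j) = 2 *\<^sub>R a j *\<^sub>R (ext_gen (e (2*j-1)) * ext_gen (e (2*j)))"
      using ext_gen_anticomm[of "e (2*j)" "e (2*j-1)"]
      by (simp add: ext_gen_scaleR linear_neg[OF linear_ext_gen] flip: scaleR_2)
  qed
  finally have "2 *\<^sub>R v = 2 *\<^sub>R block_bivector ?k e a"
    by (simp add: block_bivector_def scaleR_sum_right)
  then show ?thesis by simp
qed

lemma bivector_normal_form:
  assumes m: "3 \<le> m" and v: "v \<in> ext_pow 2"
  obtains \<phi> w where "\<phi> \<in> SO" "w \<in> normal_vectors \<xi> m" "v = ext_map \<phi> w"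
proof -
  let ?k = "m div 2"
  obtain A where A: "skew A" "\<And>x. ext_gen (A x) = D x v" using bivector_operator[OF v] by blast
  obtain e a where e: "onb e" "block_frame A ?k e a" "odd m \<Longrightarrow> A (e m) = 0"
    and mono: "\<forall>j\<in>{1..<?k}. a (Suc j) \<le> a j"
    using skew_normal_form[OF A(1)] by blast
  have v_eq: "v = block_bivector ?k e a" by (rule bivector_eq_block_bivector[OF v A e])
  have pos: "\<And>j. j \<in> {1..?k} \<Longrightarrow> 0 \<le> a j" using e(2) by (simp add: block_frame_def)
  have "\<exists>e a. onb e \<and> ext_mon (map e [1..<Suc m]) = L \<and> v = block_bivector ?k e a \<and> a \<in> normal_coefficients m"
    using e(1)
  proof (cases rule: onb_volume)
    case 1
    have "a \<in> normal_coefficients m"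
      using pos[of ?k] mono m mono[THEN bspec, of "?k - 1"] by (auto simp: normal_coefficients_def Let_def)
    then show ?thesis using e(1) 1 v_eq by blast
  next
    case 2
    \<comment> \<open>The frame is negatively oriented. It is the last vector that is reversed
      because the chain of inequalities tolerates a negative sign only in the last
      coefficient.\<close>
    let ?e = "e(m := - e m)"
    have m1: "[1..<Suc m] = [1..<m] @ [m]" using m by (simp add: upt_Suc)
    have "map ?e [1..<m] = map e [1..<m]" by simp
    then have L: "ext_mon (map ?e [1..<Suc m]) = L"
      using 2 by (simp add: m1 linear_neg[OF linear_ext_gen] del: map_eq_conv)
    have onb: "onb ?e"
      by (rule onbI) (auto simp: B_minus onb_B[OF e(1)])
    show ?thesis
    proof (cases "even m")
      case False
      then have "block_bivector ?k ?e a = v"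
        unfolding v_eq by (intro block_bivector_cong) (auto elim!: oddE)
      moreover have "a \<in> normal_coefficients m"
        using pos[of ?k] mono m False by (auto simp: normal_coefficients_def Let_def)
      ultimately show ?thesis using onb L by blast
    next
      case True
      then have k: "m = 2 * ?k" "2 \<le> ?k" using m by presburger+
      have "v = block_bivector ?k ?e (a(?k := - a ?k))"
        unfolding v_eq block_bivector_def
      proof (rule sum.cong[OF refl])
        fix j assume j: "j \<in> {1..?k}"
        then have 1: "2 * j - 1 \<noteq> m" using k by auto
        show "a j *\<^sub>R (ext_gen (e (2*j-1)) * ext_gen (e (2*j)))
          = (a(?k := - a ?k)) j *\<^sub>R (ext_gen (?e (2*j-1)) * ext_gen (?e (2*j)))"
        proof (cases "j = ?k")
          case True
          then show ?thesis using k(1) 1 by (simp add: linear_neg[OF linear_ext_gen])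
        next
          case False
          then have "2 * j \<noteq> m" using k by simp
          then show ?thesis using False 1 by simp
        qed
      qed
      moreover have "a(?k := - a ?k) \<in> normal_coefficients m"
        using pos[of ?k] mono m True mono[THEN bspec, of "?k - 1"] k(2)
        by (auto simp: normal_coefficients_def Let_def)
      ultimately show ?thesis using onb L by blast
    qed
  qed
  then obtain e a where e: "onb e" "ext_mon (map e [1..<Suc m]) = L"
    and v: "v = block_bivector ?k e a" and a: "a \<in> normal_coefficients m" by blast
  note f = frame_map[OF e(1)]
  have "frame_map e \<in> SO" using f e(2) by (simp add: SO_iff)
  moreover have "ext_map (frame_map e) (block_bivector ?k \<xi> a) = v"
    unfolding v ext_map_block_bivector[OF f(1)] by (rule block_bivector_cong, rule f(3)) auto
  ultimately show ?thesis using that a by (auto simp: normal_vectors_eq)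
qed

section \<open>Uniqueness of the coefficients\<close>

definition block_operator :: "(nat \<Rightarrow> real) \<Rightarrow> 'v \<Rightarrow> 'v" where
  "block_operator a x =
     (\<Sum>j=1..m div 2. a j *\<^sub>R (B x (\<xi> (2*j-1)) *\<^sub>R \<xi> (2*j) - B x (\<xi> (2*j)) *\<^sub>R \<xi> (2*j-1)))"

lemma D_block_bivector: "D x (block_bivector (m div 2) \<xi> a) = ext_gen (block_operator a x)"
  by (simp add: block_bivector_def block_operator_def D_sum D_scale D_mult D_gen linear_sum[OF linear_ext_gen]
      linear_diff[OF linear_ext_gen] ext_gen_scaleR)

text \<open>The squared norm of the projection to plane \<open>j\<close>, on which
  \<open>block_operator\<close> scales lengths by \<open>\<bar>a j\<bar>\<close>.\<close>

definition pair_sq :: "'v \<Rightarrow> nat \<Rightarrow> real" where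
  "pair_sq x j = (B x (\<xi> (2*j-1)))\<^sup>2 + (B x (\<xi> (2*j)))\<^sup>2"

lemma pair_sq_nonneg: "0 \<le> pair_sq x j"
  by (simp add: pair_sq_def)

lemma block_operator_sq:
  "B (block_operator a x) (block_operator a x) = (\<Sum>j=1..m div 2. (a j)\<^sup>2 * pair_sq x j)"
proof -
  let ?t = "\<lambda>j. a j *\<^sub>R (B x (\<xi> (2*j-1)) *\<^sub>R \<xi> (2*j) - B x (\<xi> (2*j)) *\<^sub>R \<xi> (2*j-1))"
  have t: "B (?t i) (?t j) = (if i = j then (a j)\<^sup>2 * pair_sq x j else 0)"
    if "i \<in> {1..m div 2}" "j \<in> {1..m div 2}" for i j
  proof -
    have "2*i \<in> {1..m}" "2*i-1 \<in> {1..m}" "2*j \<in> {1..m}" "2*j-1 \<in> {1..m}" using that by auto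
    moreover have "2*i \<noteq> 2*j-1" "2*i-1 \<noteq> 2*j" "2*i-1 = 2*j-1 \<longleftrightarrow> i = j"
      using that by (auto, presburger+)
    ultimately show ?thesis
      by (simp add: B_scale B_diff onb_B[OF basis] pair_sq_def power2_eq_square algebra_simps)
  qed
  have "B (block_operator a x) (block_operator a x)
      = (\<Sum>j=1..m div 2. \<Sum>i=1..m div 2. B (?t i) (?t j))"
    unfolding block_operator_def by (subst B_sum(2), subst B_sum(1)) simp
  also have "\<dots> = (\<Sum>j=1..m div 2. \<Sum>i=1..m div 2. if i = j then (a j)\<^sup>2 * pair_sq x j else 0)"
    by (intro sum.cong refl t)
  finally show ?thesis by simp
qed

text \<open>Bessel's inequality; for odd \<open>m\<close> the last coordinate belongs to no
  plane.\<close>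

lemma sum_pair_sq_le: "(\<Sum>j=1..m div 2. pair_sq x j) \<le> B x x"
proof -
  have "(\<Sum>j=1..m div 2. pair_sq x j) = (\<Sum>i=1..2*(m div 2). (B x (\<xi> i))\<^sup>2)"
    unfolding sum_pairs pair_sq_def ..
  also have "\<dots> \<le> (\<Sum>i=1..m. (B x (\<xi> i))\<^sup>2)" by (rule sum_mono2) auto
  finally show ?thesis using onb_parseval[OF basis, of x x] by (simp add: power2_eq_square)
qed

lemma sum_pair_sq_eq:
  assumes "x \<in> span (\<xi> ` {1..2*j})" "j \<le> m div 2"
  shows "(\<Sum>l=1..j. pair_sq x l) = B x x"
proof -
  have "B x (\<xi> i) = 0" if "i \<in> {1..m} - {1..2*j}" for i
    using assms(1)
  proof (induction x rule: span_induct_alt)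
    case (step c y z)
    then obtain l where "l \<in> {1..2*j}" "y = \<xi> l" by blast
    then show ?case using step that assms(2) onb_B[OF basis, of l i] by (auto simp: B_add B_scale)
  qed (simp add: B_0)
  then have "(\<Sum>i=1..m. (B x (\<xi> i))\<^sup>2) = (\<Sum>i=1..2*j. (B x (\<xi> i))\<^sup>2)"
    using assms(2) by (intro sum.mono_neutral_right) auto
  then show ?thesis
    using onb_parseval[OF basis, of x x] by (simp add: sum_pairs pair_sq_def power2_eq_square)
qed

text \<open>Courant--Fischer: some \<open>x \<noteq> 0\<close> in the span of the first \<open>2j\<close> basis vectors is mapped by \<open>\<phi>\<close>
  into the orthogonal complement of the first \<open>2j - 2\<close> ones.\<close>

lemma block_coefficient_le:
  assumes \<phi>: "\<phi> \<in> SO" and eq: "ext_map \<phi> (block_bivector (m div 2) \<xi> a) = block_bivector (m div 2) \<xi> b"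
    and a: "\<And>l j. 1 \<le> l \<Longrightarrow> l \<le> j \<Longrightarrow> j \<le> m div 2 \<Longrightarrow> \<bar>a j\<bar> \<le> \<bar>a l\<bar>"
    and b: "\<And>l j. 1 \<le> l \<Longrightarrow> l \<le> j \<Longrightarrow> j \<le> m div 2 \<Longrightarrow> \<bar>b j\<bar> \<le> \<bar>b l\<bar>"
    and j: "j \<in> {1..m div 2}"
  shows "\<bar>a j\<bar> \<le> \<bar>b j\<bar>"
proof -
  let ?k = "m div 2"
  note \<phi>' = SO_D[OF \<phi>]
  obtain \<psi> where \<psi>: "\<And>x. \<phi> (\<psi> x) = x" using SO_inverse[OF \<phi>] by blast
  have "inj_on \<xi> {1..m}" using basis by (simp add: orthonormal_basis_def)
  then have "inj_on \<xi> {1..2*j}" by (rule inj_on_subset) (use j in auto)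
  then have card: "card (\<xi> ` {1..2*j}) = 2*j" by (simp add: card_image)
  have ind: "independent (\<xi> ` {1..2*j})"
    by (rule independent_mono[OF finite_basis(1)]) (use j in auto)
  have "2*j-2 < card (\<xi> ` {1..2*j})" "2*j-2 \<le> m" using card j by auto
  \<comment> \<open>There are \<open>2 * j\<close> basis vectors against \<open>2 * j - 2\<close>
    conditions. The conditions are pulled back along \<open>\<psi>\<close>, since it is
    \<open>\<phi> x\<close> that has to be orthogonal.\<close>
  then obtain x where x: "x \<in> span (\<xi> ` {1..2*j})" "x \<noteq> 0" "\<And>i. i \<in> {1..2*j-2} \<Longrightarrow> B x (\<psi> (\<xi> i)) = 0"
    by (rule exists_orthogonal[OF ind, where f = "\<lambda>i. \<psi> (\<xi> i)"]) blast
  have y: "B (\<phi> x) (\<xi> i) = 0" if "i \<in> {1..2*j-2}" for i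
    using \<phi>'(2)[of x "\<psi> (\<xi> i)"] x(3)[OF that] by (simp add: \<psi>)
  have "ext_gen (\<phi> (block_operator a x)) = ext_gen (block_operator b (\<phi> x))"
    unfolding D_block_bivector[symmetric] eq[symmetric]
    by (simp add: ext_map_D[OF \<phi>'(1,2), symmetric] D_block_bivector ext_map_gen[OF \<phi>'(1)])
  then have "\<phi> (block_operator a x) = block_operator b (\<phi> x)" by (simp add: inj_ext_gen)
  \<comment> \<open>Both operators have the same squared length at corresponding vectors. It is at
    least \<open>(a j)\<^sup>2 * B x x\<close> by the left side and at most
    \<open>(b j)\<^sup>2 * B x x\<close> by the right side.\<close>
  then have q: "(\<Sum>l=1..?k. (a l)\<^sup>2 * pair_sq x l) = (\<Sum>l=1..?k. (b l)\<^sup>2 * pair_sq (\<phi> x) l)"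
    unfolding block_operator_sq[symmetric] by (metis \<phi>'(2))
  have "(a j)\<^sup>2 * B x x = (\<Sum>l=1..j. (a j)\<^sup>2 * pair_sq x l)"
    using sum_pair_sq_eq[OF x(1)] j by (simp add: sum_distrib_left[symmetric])
  also have "\<dots> \<le> (\<Sum>l=1..j. (a l)\<^sup>2 * pair_sq x l)"
  proof (rule sum_mono)
    fix l assume "l \<in> {1..j}"
    then have "(a j)\<^sup>2 \<le> (a l)\<^sup>2" using a[of l j] j by (simp add: abs_le_square_iff[symmetric])
    then show "(a j)\<^sup>2 * pair_sq x l \<le> (a l)\<^sup>2 * pair_sq x l"
      by (rule mult_right_mono) (rule pair_sq_nonneg)
  qed
  also have "\<dots> \<le> (\<Sum>l=1..?k. (a l)\<^sup>2 * pair_sq x l)"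
    by (rule sum_mono2) (use j in \<open>auto simp: pair_sq_nonneg\<close>)
  also have "\<dots> \<le> (\<Sum>l=1..?k. (b j)\<^sup>2 * pair_sq (\<phi> x) l)"
    unfolding q
  proof (rule sum_mono)
    fix l assume l: "l \<in> {1..?k}"
    show "(b l)\<^sup>2 * pair_sq (\<phi> x) l \<le> (b j)\<^sup>2 * pair_sq (\<phi> x) l"
    proof (cases "l < j")
      case True
      then have "2*l-1 \<in> {1..2*j-2}" "2*l \<in> {1..2*j-2}" using l by auto
      then have "pair_sq (\<phi> x) l = 0" using y by (simp add: pair_sq_def)
      then show ?thesis by simp
    next
      case False
      then have "(b l)\<^sup>2 \<le> (b j)\<^sup>2" using b[of j l] j l by (simp add: abs_le_square_iff[symmetric])
      then show ?thesis by (rule mult_right_mono) (rule pair_sq_nonneg)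
    qed
  qed
  also have "\<dots> \<le> (b j)\<^sup>2 * B (\<phi> x) (\<phi> x)"
    unfolding sum_distrib_left[symmetric] by (rule mult_left_mono[OF sum_pair_sq_le]) simp
  also have "\<dots> = (b j)\<^sup>2 * B x x" by (simp add: \<phi>'(2))
  finally have "(a j)\<^sup>2 \<le> (b j)\<^sup>2" using B_gt_0[OF x(2)] by (simp add: mult_le_cancel_right)
  then show ?thesis by (simp add: abs_le_square_iff)
qed

lemma L_nonzero: "L \<noteq> 0"
  using star_L \<sigma>_nz by (auto simp: linear_0[OF linear_star])

text \<open>The product of the coefficients sees orientation: the \<open>k\<close>-th power of the
  bivector is a multiple of \<open>L\<close>, and \<open>\<phi>\<close> fixes
  \<open>L\<close>.\<close>

lemma block_coefficient_prod:
  assumes "\<phi> \<in> SO" "ext_map \<phi> (block_bivector k \<xi> a) = block_bivector k \<xi> b" "m = 2 * k"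
  shows "(\<Prod>j=1..k. a j) = (\<Prod>j=1..k. b j)"
proof -
  note \<phi> = SO_D[OF assms(1)]
  have p: "block_bivector k \<xi> c ^ k = (fact k * (\<Prod>j=1..k. c j)) *\<^sub>R L" for c
    using block_bivector_power[of k \<xi> c] by (simp add: L_def flip: assms(3))
  have "ext_map \<phi> (block_bivector k \<xi> a ^ k) = block_bivector k \<xi> b ^ k"
    by (simp add: ext_map_power[OF \<phi>(1)] assms(2))
  then have "(fact k * (\<Prod>j=1..k. a j)) *\<^sub>R L = (fact k * (\<Prod>j=1..k. b j)) *\<^sub>R L"
    by (simp add: p linear_scale[OF linear_ext_map[OF \<phi>(1)]] \<phi>(3))
  then show ?thesis using L_nonzero by simp
qed

lemma normal_vectors_unique:
  assumes m: "3 \<le> m" and v: "v \<in> normal_vectors \<xi> m" "w \<in> normal_vectors \<xi> m"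
    and \<phi>: "\<phi> \<in> SO" "w = ext_map \<phi> v"
  shows "v = w"
proof -
  let ?k = "m div 2"
  obtain a b where a: "a \<in> normal_coefficients m" "v = block_bivector ?k \<xi> a"
    and b: "b \<in> normal_coefficients m" "w = block_bivector ?k \<xi> b"
    using v by (auto simp: normal_vectors_eq)
  obtain \<psi> where \<psi>: "\<psi> \<in> SO" "\<And>x. \<psi> (\<phi> x) = x" using SO_inverse[OF \<phi>(1)] by blast
  have vw: "ext_map \<psi> w = v"
    using ext_map_comp[OF SO_D(1)[OF \<phi>(1)] SO_D(1)[OF \<psi>(1)], of v] by (simp add: \<phi>(2) \<psi>(2) ext_map_id)
  note na = normal_coefficientsD[OF m a(1)] and nb = normal_coefficientsD[OF m b(1)]
  \<comment> \<open>The coefficient estimate is one-sided; the inverse isometry supplies the other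
    side.\<close>
  have abs: "\<bar>a j\<bar> = \<bar>b j\<bar>" if "j \<in> {1..?k}" for j
  proof (rule order_antisym)
    show "\<bar>a j\<bar> \<le> \<bar>b j\<bar>"
      by (rule block_coefficient_le[OF \<phi>(1) _ na(2) nb(2) that]) (use \<phi>(2) a(2) b(2) in simp_all)
    show "\<bar>b j\<bar> \<le> \<bar>a j\<bar>"
      by (rule block_coefficient_le[OF \<psi>(1) _ nb(2) na(2) that]) (use vw a(2) b(2) in simp_all)
  qed
  have eq: "a j = b j" if "j \<in> {1..?k}" "odd m \<or> j < ?k" for j
    using abs[OF that(1)] na(1)[of j] nb(1)[of j] that by auto
  have "a j = b j" if j: "j \<in> {1..?k}" for j
  proof (cases "odd m \<or> j < ?k")
    case True
    then show ?thesis using eq j by blast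
  next
    case False
    then have k: "j = ?k" "m = 2 * ?k" using j by auto
    show ?thesis
    proof (cases "a j = 0")
      case True
      then show ?thesis using abs[OF j] by simp
    next
      case False
      have I: "{1..?k} = insert ?k {1..<?k}" using j k by auto
      have "(\<Prod>j=1..?k. a j) = (\<Prod>j=1..?k. b j)"
        using block_coefficient_prod[OF \<phi>(1) _ k(2)] \<phi>(2) a(2) b(2) by simp
      moreover have "(\<Prod>j\<in>{1..<?k}. b j) = (\<Prod>j\<in>{1..<?k}. a j)"
        by (rule prod.cong) (use eq in auto)
      \<comment> \<open>As absolute values decrease, a nonzero last coefficient keeps all earlier
        ones from vanishing, so they cancel from the two products.\<close>
      moreover have "(\<Prod>j\<in>{1..<?k}. a j) \<noteq> 0"
      proof -
        have "a l \<noteq> 0" if "l \<in> {1..<?k}" for l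
          using na(2)[of l j] that k(1) False by auto
        then show ?thesis by simp
      qed
      ultimately show ?thesis unfolding I by (simp add: k(1))
    qed
  qed
  then show ?thesis unfolding a(2) b(2) block_bivector_def by simp
qed

end

section \<open>The parametrization of the isomorphism classes\<close>

theorem theorem3:
  fixes B :: "'v::real_vector \<Rightarrow> 'v \<Rightarrow> real" and \<xi> :: "nat \<Rightarrow> 'v" and m :: nat
  assumes bilinear: "bilinear B"
    and symmetric: "\<And>a b. B a b = B b a"
    and nondegenerate: "\<And>a. (\<And>b. B a b = 0) \<Longrightarrow> a = 0"
    and basis: "orthonormal_basis B m \<xi>"
    and m: "3 \<le> m"
  shows "(\<forall>v\<in>normal_vectors \<xi> m. hodge_star B \<xi> m v \<in> ext_pow ((m - 3) + 1) \<and>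
           derived_structure B (m - 3) (hodge_star B \<xi> m v) \<in> invariant_structures B (m - 3)) \<and>
         bij_betw
           (\<lambda>v. structure_iso B \<xi> m (m - 3) `` {derived_structure B (m - 3) (hodge_star B \<xi> m v)})
           (normal_vectors \<xi> m)
           (invariant_structures B (m - 3) // structure_iso B \<xi> m (m - 3))"
proof -
  interpret orthonormal B m \<xi>
    by unfold_locales (rule bilinear symmetric basis)+
  have N: "v \<in> ext_pow 2" if "v \<in> normal_vectors \<xi> m" for v
    using that by (auto simp: normal_vectors_eq block_bivector_in_pow)
  note equiv = equiv_iso[OF m]
  note inv = bivector_structure_invariant[OF m N]
  have "bij_betw (\<lambda>v. struct_iso `` {bivector_structure v}) (normal_vectors \<xi> m)
      (invariant_structures B (m - 3) // struct_iso)"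
    unfolding bij_betw_def
  proof (intro conjI equalityI subsetI)
    show "inj_on (\<lambda>v. struct_iso `` {bivector_structure v}) (normal_vectors \<xi> m)"
    proof (rule inj_onI)
      fix v w assume v: "v \<in> normal_vectors \<xi> m" and w: "w \<in> normal_vectors \<xi> m"
        and eq: "struct_iso `` {bivector_structure v} = struct_iso `` {bivector_structure w}"
      have "(bivector_structure v, bivector_structure w) \<in> struct_iso"
        using eq_equiv_class[OF eq equiv inv[OF w]] .
      then obtain \<phi> where "\<phi> \<in> SO" "w = ext_map \<phi> v"
        using iso_bivector_structureD[OF m N[OF v] N[OF w]] by blast
      then show "v = w" by (rule normal_vectors_unique[OF m v w])
    qed
  next
    fix C assume "C \<in> (\<lambda>v. struct_iso `` {bivector_structure v}) ` normal_vectors \<xi> m"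
    then obtain v where "v \<in> normal_vectors \<xi> m" "C = struct_iso `` {bivector_structure v}" by blast
    then show "C \<in> invariant_structures B (m - 3) // struct_iso" by (simp add: quotientI inv)
  next
    fix C assume "C \<in> invariant_structures B (m - 3) // struct_iso"
    then obtain f where f: "f \<in> invariant_structures B (m - 3)" "C = struct_iso `` {f}"
      by (auto elim: quotientE)
    obtain u where u: "u \<in> ext_pow 2" "f = bivector_structure u"
      using bivector_structure_surj[OF m f(1)] by blast
    obtain \<phi> v where v: "\<phi> \<in> SO" "v \<in> normal_vectors \<xi> m" "u = ext_map \<phi> v"
      using bivector_normal_form[OF m u(1)] by blast
    have "C = struct_iso `` {bivector_structure v}"
      using equiv_class_eq[OF equiv iso_bivector_structure[OF m v(1) N[OF v(2)]]] f(2) u(2) v(3) by simp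
    then show "C \<in> (\<lambda>v. struct_iso `` {bivector_structure v}) ` normal_vectors \<xi> m" using v(2) by blast
  qed
  then show ?thesis using star_bivector[OF m N] inv by (simp flip: Suc_eq_plus1)
qed

end
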